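(* Let $R$ be a right noetherian ring and let $P$ and $Q$ be prime ideals of $R$. If $\mathrm{Ext}^1_R(R/P,\mathrm{ann}_{E_Q}(Q))\neq 0$, then $\mathrm{Ext}^1_R(R/P,\mathrm{ann}_E(Q))\neq 0$ for all indecomposable injective right $R$-modules $E$ with assassinator $Q$.
   Context: Modules are right modules. $\mathrm{ann}_M(Q)=\{x\in M: xQ=0\}$. $E_Q$ is the injective hull, as a right $R$-module, of any uniform right ideal of $R/Q$ (unique up to isomorphism). The assassinator of an indecomposable injective module over a right noetherian ring is its unique associated prime. *)

theory Defs
  imports "HOL-Algebra.QuotRing" "HOL-Algebra.Ideal_Product"
begin

section \<open>Right modules\<close>

text \<open>
  As for the library's modules, the record extends \<^typ>\<open>'m ring\<close> only for the sake of its
  additive part; the fields for multiplication and one are ignored. The library's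
  module locale asks for a commutative ring, so it is not applicable here.
\<close>

record ('r, 'm) rmodule = "'m ring" +
  rsmult :: "'m \<Rightarrow> 'r \<Rightarrow> 'm"  (infixl \<open>\<odot>\<^sub>r\<index>\<close> 70)

locale right_module = R?: ring R + M: abelian_group M
  for R :: "('r, 'x) ring_scheme" (structure) and M :: "('r, 'm) rmodule" +
  assumes rsmult_closed: "\<lbrakk>x \<in> carrier M; r \<in> carrier R\<rbrakk> \<Longrightarrow> x \<odot>\<^sub>r\<^bsub>M\<^esub> r \<in> carrier M"
    and rsmult_l_distr: "\<lbrakk>x \<in> carrier M; y \<in> carrier M; r \<in> carrier R\<rbrakk>
      \<Longrightarrow> (x \<oplus>\<^bsub>M\<^esub> y) \<odot>\<^sub>r\<^bsub>M\<^esub> r = x \<odot>\<^sub>r\<^bsub>M\<^esub> r \<oplus>\<^bsub>M\<^esub> y \<odot>\<^sub>r\<^bsub>M\<^esub> r"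
    and rsmult_r_distr: "\<lbrakk>x \<in> carrier M; r \<in> carrier R; s \<in> carrier R\<rbrakk>
      \<Longrightarrow> x \<odot>\<^sub>r\<^bsub>M\<^esub> (r \<oplus> s) = x \<odot>\<^sub>r\<^bsub>M\<^esub> r \<oplus>\<^bsub>M\<^esub> x \<odot>\<^sub>r\<^bsub>M\<^esub> s"
    and rsmult_assoc: "\<lbrakk>x \<in> carrier M; r \<in> carrier R; s \<in> carrier R\<rbrakk>
      \<Longrightarrow> x \<odot>\<^sub>r\<^bsub>M\<^esub> (r \<otimes> s) = (x \<odot>\<^sub>r\<^bsub>M\<^esub> r) \<odot>\<^sub>r\<^bsub>M\<^esub> s"
    and rsmult_one: "x \<in> carrier M \<Longrightarrow> x \<odot>\<^sub>r\<^bsub>M\<^esub> \<one> = x"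

definition submod :: "('r, 'x) ring_scheme \<Rightarrow> ('r, 'm) rmodule \<Rightarrow> 'm set \<Rightarrow> bool" where
  "submod R M N \<longleftrightarrow> subgroup N (add_monoid M) \<and> (\<forall>x\<in>N. \<forall>r\<in>carrier R. x \<odot>\<^sub>r\<^bsub>M\<^esub> r \<in> N)"

text \<open>A submodule \<open>N\<close> of \<open>M\<close>, regarded as a module, is \<open>M\<lparr>carrier := N\<rparr>\<close>.\<close>

definition rmod_hom ::
  "('r, 'x) ring_scheme \<Rightarrow> ('r, 'm) rmodule \<Rightarrow> ('r, 'n) rmodule \<Rightarrow> ('m \<Rightarrow> 'n) set" where
  "rmod_hom R M N = {f \<in> carrier M \<rightarrow>\<^sub>E carrier N.
     (\<forall>x\<in>carrier M. \<forall>y\<in>carrier M. f (x \<oplus>\<^bsub>M\<^esub> y) = f x \<oplus>\<^bsub>N\<^esub> f y) \<and>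
     (\<forall>x\<in>carrier M. \<forall>r\<in>carrier R. f (x \<odot>\<^sub>r\<^bsub>M\<^esub> r) = f x \<odot>\<^sub>r\<^bsub>N\<^esub> r)}"

definition right_regular :: "('r, 'x) ring_scheme \<Rightarrow> ('r, 'r) rmodule" where
  "right_regular R = \<lparr>carrier = carrier R, mult = mult R, one = one R, zero = zero R,
     add = add R, rsmult = mult R\<rparr>"

definition right_ideal :: "('r, 'x) ring_scheme \<Rightarrow> 'r set \<Rightarrow> bool" where
  "right_ideal R I \<longleftrightarrow> submod R (right_regular R) I"

definition right_noetherian :: "('r, 'x) ring_scheme \<Rightarrow> bool" where
  "right_noetherian R \<longleftrightarrow> ring R \<and>
     (\<forall>I :: nat \<Rightarrow> 'r set. (\<forall>n. right_ideal R (I n) \<and> I n \<subseteq> I (Suc n)) \<longrightarrow>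
        (\<exists>n. \<forall>m\<ge>n. I m = I n))"

text \<open>
  Primeness for noncommutative rings, in terms of products of two-sided ideals. (The library's
  \<^const>\<open>primeideal\<close> is about commutative rings and elements.)
\<close>

definition prime_ideal :: "('r, 'x) ring_scheme \<Rightarrow> 'r set \<Rightarrow> bool" where
  "prime_ideal R P \<longleftrightarrow> ideal P R \<and> P \<noteq> carrier R \<and>
     (\<forall>I J. ideal I R \<and> ideal J R \<and> I \<cdot>\<^bsub>R\<^esub> J \<subseteq> P \<longrightarrow> I \<subseteq> P \<or> J \<subseteq> P)"

text \<open>The right \<open>R\<close>-module \<open>R/I\<close> for a two-sided ideal \<open>I\<close>.\<close>

definition factor_rmodule :: "('r, 'x) ring_scheme \<Rightarrow> 'r set \<Rightarrow> ('r, 'r set) rmodule" where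
  "factor_rmodule R I = \<lparr>carrier = carrier (R Quot I), mult = mult (R Quot I),
     one = one (R Quot I), zero = zero (R Quot I), add = add (R Quot I),
     rsmult = (\<lambda>X r. X \<otimes>\<^bsub>R Quot I\<^esub> (I +>\<^bsub>R\<^esub> r))\<rparr>"

definition ann_in :: "('r, 'm) rmodule \<Rightarrow> 'r set \<Rightarrow> 'm set" where
  "ann_in M Q = {x \<in> carrier M. \<forall>q\<in>Q. x \<odot>\<^sub>r\<^bsub>M\<^esub> q = \<zero>\<^bsub>M\<^esub>}"

definition annihilator :: "('r, 'x) ring_scheme \<Rightarrow> ('r, 'm) rmodule \<Rightarrow> 'm set \<Rightarrow> 'r set" where
  "annihilator R M N = {r \<in> carrier R. \<forall>x\<in>N. x \<odot>\<^sub>r\<^bsub>M\<^esub> r = \<zero>\<^bsub>M\<^esub>}"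

section \<open>Uniform and indecomposable modules, associated primes\<close>

definition uniform_rmodule :: "('r, 'x) ring_scheme \<Rightarrow> ('r, 'm) rmodule \<Rightarrow> bool" where
  "uniform_rmodule R M \<longleftrightarrow> right_module R M \<and> carrier M \<noteq> {\<zero>\<^bsub>M\<^esub>} \<and>
     (\<forall>A B. submod R M A \<and> submod R M B \<and> A \<noteq> {\<zero>\<^bsub>M\<^esub>} \<and> B \<noteq> {\<zero>\<^bsub>M\<^esub>} \<longrightarrow> A \<inter> B \<noteq> {\<zero>\<^bsub>M\<^esub>})"

definition essential_submod :: "('r, 'x) ring_scheme \<Rightarrow> ('r, 'm) rmodule \<Rightarrow> 'm set \<Rightarrow> bool" where
  "essential_submod R M N \<longleftrightarrow> submod R M N \<and>
     (\<forall>A. submod R M A \<and> A \<noteq> {\<zero>\<^bsub>M\<^esub>} \<longrightarrow> A \<inter> N \<noteq> {\<zero>\<^bsub>M\<^esub>})"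

definition indecomposable_rmodule :: "('r, 'x) ring_scheme \<Rightarrow> ('r, 'm) rmodule \<Rightarrow> bool" where
  "indecomposable_rmodule R M \<longleftrightarrow> right_module R M \<and> carrier M \<noteq> {\<zero>\<^bsub>M\<^esub>} \<and>
     (\<forall>A B. submod R M A \<and> submod R M B \<and> A <+>\<^bsub>M\<^esub> B = carrier M \<and> A \<inter> B = {\<zero>\<^bsub>M\<^esub>}
        \<longrightarrow> A = {\<zero>\<^bsub>M\<^esub>} \<or> B = {\<zero>\<^bsub>M\<^esub>})"

text \<open>
  An associated prime is a prime ideal that is the annihilator of a prime submodule, that is,
  of a nonzero submodule all of whose nonzero submodules have the same annihilator.
\<close>

definition prime_submod :: "('r, 'x) ring_scheme \<Rightarrow> ('r, 'm) rmodule \<Rightarrow> 'm set \<Rightarrow> bool" where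
  "prime_submod R M N \<longleftrightarrow> submod R M N \<and> N \<noteq> {\<zero>\<^bsub>M\<^esub>} \<and>
     (\<forall>A. submod R M A \<and> A \<subseteq> N \<and> A \<noteq> {\<zero>\<^bsub>M\<^esub>} \<longrightarrow> annihilator R M A = annihilator R M N)"

definition associated_primes :: "('r, 'x) ring_scheme \<Rightarrow> ('r, 'm) rmodule \<Rightarrow> 'r set set" where
  "associated_primes R M =
     {Q. prime_ideal R Q \<and> (\<exists>N. prime_submod R M N \<and> Q = annihilator R M N)}"

definition is_assassinator :: "('r, 'x) ring_scheme \<Rightarrow> ('r, 'm) rmodule \<Rightarrow> 'r set \<Rightarrow> bool" where
  "is_assassinator R M Q \<longleftrightarrow> associated_primes R M = {Q}"

section \<open>Injective modules and injective hulls\<close>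

text \<open>
  The extension property with respect to all modules whose elements are taken from a given type.
\<close>

definition injective_for ::
  "'b itself \<Rightarrow> ('r, 'x) ring_scheme \<Rightarrow> ('r, 'e) rmodule \<Rightarrow> bool" where
  "injective_for T R E \<longleftrightarrow> right_module R E \<and>
     (\<forall>B :: ('r, 'b) rmodule. \<forall>A. \<forall>f \<in> rmod_hom R (B\<lparr>carrier := A\<rparr>) E.
        right_module R B \<and> submod R B A \<longrightarrow> (\<exists>g \<in> rmod_hom R B E. \<forall>x\<in>A. g x = f x))"

text \<open>
  A formula cannot quantify over types, so a type for the test modules has to be chosen. The
  choice of the type of ring elements loses nothing: by Baer's criterion, proved below as
  \<open>injective_rmodule_imp_injective_for\<close>, the extension property then holds with respect to
  modules over any type whatsoever.
\<close>

definition injective_rmodule :: "('r, 'x) ring_scheme \<Rightarrow> ('r, 'e) rmodule \<Rightarrow> bool" where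
  "injective_rmodule R E \<longleftrightarrow> injective_for TYPE('r) R E"

definition is_injective_hull ::
  "('r, 'x) ring_scheme \<Rightarrow> ('r, 'm) rmodule \<Rightarrow> ('r, 'e) rmodule \<Rightarrow> bool" where
  "is_injective_hull R M E \<longleftrightarrow> injective_rmodule R E \<and>
     (\<exists>i \<in> rmod_hom R M E. inj_on i (carrier M) \<and> essential_submod R E (i ` carrier M))"

text \<open>
  \<open>E\<close> is a version of \<open>E\<^sub>Q\<close>: the injective hull, as an \<open>R\<close>-module, of some uniform right ideal
  of the ring \<open>R/Q\<close>.
\<close>

definition is_EQ :: "('r, 'x) ring_scheme \<Rightarrow> 'r set \<Rightarrow> ('r, 'e) rmodule \<Rightarrow> bool" where
  "is_EQ R Q E \<longleftrightarrow>
     (\<exists>V. right_ideal (R Quot Q) V \<and>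
        uniform_rmodule (R Quot Q) ((right_regular (R Quot Q))\<lparr>carrier := V\<rparr>) \<and>
        is_injective_hull R ((factor_rmodule R Q)\<lparr>carrier := V\<rparr>) E)"

section \<open>Ext\<close>

text \<open>The free right module with basis \<open>S\<close>: finitely supported functions \<open>S \<rightarrow> R\<close>.\<close>

definition free_rmodule :: "('r, 'x) ring_scheme \<Rightarrow> 's set \<Rightarrow> ('r, 's \<Rightarrow> 'r) rmodule" where
  "free_rmodule R S = \<lparr>
     carrier = {c. (\<forall>s\<in>S. c s \<in> carrier R) \<and> (\<forall>s. s \<notin> S \<longrightarrow> c s = \<zero>\<^bsub>R\<^esub>) \<and>
                   finite {s. c s \<noteq> \<zero>\<^bsub>R\<^esub>}},
     mult = undefined, one = undefined,
     zero = (\<lambda>s. \<zero>\<^bsub>R\<^esub>),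
     add = (\<lambda>c d s. c s \<oplus>\<^bsub>R\<^esub> d s),
     rsmult = (\<lambda>c r s. c s \<otimes>\<^bsub>R\<^esub> r)\<rparr>"

definition free_map ::
  "('r, 'x) ring_scheme \<Rightarrow> ('r, 'm) rmodule \<Rightarrow> 'm set \<Rightarrow> ('m \<Rightarrow> 'r) \<Rightarrow> 'm" where
  "free_map R M S = (\<lambda>c\<in>carrier (free_rmodule R S).
     finsum M (\<lambda>s. s \<odot>\<^sub>r\<^bsub>M\<^esub> c s) {s \<in> S. c s \<noteq> \<zero>\<^bsub>R\<^esub>})"

text \<open>
  The beginning \<open>F\<^sub>2 \<rightarrow> F\<^sub>1 \<rightarrow> F\<^sub>0 \<rightarrow> A \<rightarrow> 0\<close> of the standard free resolution of \<open>A\<close>: \<open>F\<^sub>0\<close> is free on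
  the set \<open>A\<close>, and each further term is free on the kernel of the preceding map.
\<close>

definition res_F0 :: "('r, 'x) ring_scheme \<Rightarrow> ('r, 'a) rmodule \<Rightarrow> ('r, 'a \<Rightarrow> 'r) rmodule" where
  "res_F0 R A = free_rmodule R (carrier A)"

definition res_aug :: "('r, 'x) ring_scheme \<Rightarrow> ('r, 'a) rmodule \<Rightarrow> ('a \<Rightarrow> 'r) \<Rightarrow> 'a" where
  "res_aug R A = free_map R A (carrier A)"

definition res_F1 ::
  "('r, 'x) ring_scheme \<Rightarrow> ('r, 'a) rmodule \<Rightarrow> ('r, ('a \<Rightarrow> 'r) \<Rightarrow> 'r) rmodule" where
  "res_F1 R A = free_rmodule R (a_kernel (res_F0 R A) A (res_aug R A))"

definition res_d1 ::
  "('r, 'x) ring_scheme \<Rightarrow> ('r, 'a) rmodule \<Rightarrow> (('a \<Rightarrow> 'r) \<Rightarrow> 'r) \<Rightarrow> 'a \<Rightarrow> 'r" where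
  "res_d1 R A = free_map R (res_F0 R A) (a_kernel (res_F0 R A) A (res_aug R A))"

definition res_F2 ::
  "('r, 'x) ring_scheme \<Rightarrow> ('r, 'a) rmodule \<Rightarrow> ('r, (('a \<Rightarrow> 'r) \<Rightarrow> 'r) \<Rightarrow> 'r) rmodule" where
  "res_F2 R A = free_rmodule R (a_kernel (res_F1 R A) (res_F0 R A) (res_d1 R A))"

definition res_d2 ::
  "('r, 'x) ring_scheme \<Rightarrow> ('r, 'a) rmodule \<Rightarrow> ((('a \<Rightarrow> 'r) \<Rightarrow> 'r) \<Rightarrow> 'r) \<Rightarrow> ('a \<Rightarrow> 'r) \<Rightarrow> 'r" where
  "res_d2 R A = free_map R (res_F1 R A) (a_kernel (res_F1 R A) (res_F0 R A) (res_d1 R A))"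

text \<open>The abelian group \<open>Hom\<^sub>R(M, N)\<close>, written multiplicatively.\<close>

definition Hom_group ::
  "('r, 'x) ring_scheme \<Rightarrow> ('r, 'm) rmodule \<Rightarrow> ('r, 'n) rmodule \<Rightarrow> ('m \<Rightarrow> 'n) monoid" where
  "Hom_group R M N = \<lparr>carrier = rmod_hom R M N,
     mult = (\<lambda>f g. \<lambda>x\<in>carrier M. f x \<oplus>\<^bsub>N\<^esub> g x),
     one = (\<lambda>x\<in>carrier M. \<zero>\<^bsub>N\<^esub>)\<rparr>"

text \<open>
  \<open>Ext\<^sup>1(A, B)\<close> is the first cohomology of the complex
  \<open>Hom(F\<^sub>0, B) \<rightarrow> Hom(F\<^sub>1, B) \<rightarrow> Hom(F\<^sub>2, B)\<close>. Up to isomorphism it does not depend on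
  the projective resolution, and the standard free one needs no choices.
\<close>

definition Ext1 ::
  "('r, 'x) ring_scheme \<Rightarrow> ('r, 'a) rmodule \<Rightarrow> ('r, 'b) rmodule
     \<Rightarrow> ((('a \<Rightarrow> 'r) \<Rightarrow> 'r) \<Rightarrow> 'b) set monoid" where
  "Ext1 R A B =
     (Hom_group R (res_F1 R A) B)
        \<lparr>carrier := kernel (Hom_group R (res_F1 R A) B) (Hom_group R (res_F2 R A) B)
           (\<lambda>f. compose (carrier (res_F2 R A)) f (res_d2 R A))\<rparr>
     Mod
     (\<lambda>f. compose (carrier (res_F1 R A)) f (res_d1 R A)) ` carrier (Hom_group R (res_F0 R A) B)"

definition Ext1_nonzero ::
  "('r, 'x) ring_scheme \<Rightarrow> ('r, 'a) rmodule \<Rightarrow> ('r, 'b) rmodule \<Rightarrow> bool" where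
  "Ext1_nonzero R A B \<longleftrightarrow> carrier (Ext1 R A B) \<noteq> {\<one>\<^bsub>Ext1 R A B\<^esub>}"

section \<open>Independence of the type of test modules\<close>

context right_module
begin

lemma rsmult_zero: "x \<in> carrier M \<Longrightarrow> x \<odot>\<^sub>r\<^bsub>M\<^esub> \<zero> = \<zero>\<^bsub>M\<^esub>"
  using rsmult_r_distr[of x \<zero> \<zero>] rsmult_closed[of x \<zero>] M.add.l_cancel_one by fastforce

lemma zero_rsmult: "r \<in> carrier R \<Longrightarrow> \<zero>\<^bsub>M\<^esub> \<odot>\<^sub>r\<^bsub>M\<^esub> r = \<zero>\<^bsub>M\<^esub>"
  using rsmult_l_distr[of "\<zero>\<^bsub>M\<^esub>" "\<zero>\<^bsub>M\<^esub>" r] rsmult_closed[of "\<zero>\<^bsub>M\<^esub>" r] M.add.l_cancel_one by fastforce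

lemma rsmult_minus:
  assumes "x \<in> carrier M" "r \<in> carrier R"
  shows "x \<odot>\<^sub>r\<^bsub>M\<^esub> (\<ominus> r) = \<ominus>\<^bsub>M\<^esub> (x \<odot>\<^sub>r\<^bsub>M\<^esub> r)"
proof -
  have "x \<odot>\<^sub>r\<^bsub>M\<^esub> (\<ominus> r) \<oplus>\<^bsub>M\<^esub> x \<odot>\<^sub>r\<^bsub>M\<^esub> r = \<zero>\<^bsub>M\<^esub>"
    using assms rsmult_r_distr[of x "\<ominus> r" r] by (simp add: rsmult_zero R.l_neg)
  thus ?thesis using assms by (simp add: M.minus_equality rsmult_closed)
qed

lemma rsmult_minus_one: "x \<in> carrier M \<Longrightarrow> x \<odot>\<^sub>r\<^bsub>M\<^esub> (\<ominus> \<one>) = \<ominus>\<^bsub>M\<^esub> x"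
  by (simp add: rsmult_minus rsmult_one)

lemma submodI:
  assumes "N \<subseteq> carrier M" "\<zero>\<^bsub>M\<^esub> \<in> N" "\<And>x y. x \<in> N \<Longrightarrow> y \<in> N \<Longrightarrow> x \<oplus>\<^bsub>M\<^esub> y \<in> N"
    "\<And>x r. x \<in> N \<Longrightarrow> r \<in> carrier R \<Longrightarrow> x \<odot>\<^sub>r\<^bsub>M\<^esub> r \<in> N"
  shows "submod R M N"
proof -
  have "\<ominus>\<^bsub>M\<^esub> x \<in> N" if "x \<in> N" for x
    using that assms(1) assms(4)[of x "\<ominus> \<one>"] by (auto simp: rsmult_minus_one)
  thus ?thesis unfolding submod_def
    using assms by (auto intro!: M.add.subgroupI simp: a_inv_def)
qed

end

lemma right_module_right_regular:
  assumes "ring R" shows "right_module R (right_regular R)"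
proof -
  interpret ring R by fact
  have "abelian_group (right_regular R)"
    by (rule abelian_groupI) (auto simp: right_regular_def a_ac intro: l_neg)
  thus ?thesis
    by (intro right_module.intro right_module_axioms.intro)
       (auto simp: right_regular_def l_distr r_distr m_assoc ring_axioms)
qed

lemma submod_subset: "submod R M N \<Longrightarrow> N \<subseteq> carrier M"
  using subgroup.subset by (fastforce simp: submod_def)

lemma submod_zero: "submod R M N \<Longrightarrow> \<zero>\<^bsub>M\<^esub> \<in> N"
  by (auto simp: submod_def dest: subgroup.one_closed)

lemma submod_add: "submod R M N \<Longrightarrow> x \<in> N \<Longrightarrow> y \<in> N \<Longrightarrow> x \<oplus>\<^bsub>M\<^esub> y \<in> N"
  by (auto simp: submod_def dest: subgroup.m_closed)

lemma submod_rsmult: "submod R M N \<Longrightarrow> x \<in> N \<Longrightarrow> r \<in> carrier R \<Longrightarrow> x \<odot>\<^sub>r\<^bsub>M\<^esub> r \<in> N"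
  by (auto simp: submod_def)

theorem injective_rmodule_imp_injective_for:
  fixes R :: "('r, 'x) ring_scheme" and E :: "('r, 'e) rmodule"
  assumes inj: "injective_rmodule R E"
  shows "injective_for TYPE('b) R E"
  unfolding injective_for_def
proof (intro conjI allI ballI impI; (elim conjE)?)
  show "right_module R E" using inj by (simp add: injective_rmodule_def injective_for_def)
  then interpret E: right_module R E .
  fix B :: "('r, 'b) rmodule" and A f
  assume f: "f \<in> rmod_hom R (B\<lparr>carrier := A\<rparr>) E" and "right_module R B" and A: "submod R B A"
  interpret B: right_module R B by fact
  define Z where "Z = {G. G \<subseteq> carrier B \<times> carrier E \<and>
     (\<forall>x y x' y'. (x, y) \<in> G \<longrightarrow> (x', y') \<in> G \<longrightarrow> (x \<oplus>\<^bsub>B\<^esub> x', y \<oplus>\<^bsub>E\<^esub> y') \<in> G) \<and>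
     (\<forall>x y r. (x, y) \<in> G \<longrightarrow> r \<in> carrier R \<longrightarrow> (x \<odot>\<^sub>r\<^bsub>B\<^esub> r, y \<odot>\<^sub>r\<^bsub>E\<^esub> r) \<in> G) \<and>
     (\<forall>y. (\<zero>\<^bsub>B\<^esub>, y) \<in> G \<longrightarrow> y = \<zero>\<^bsub>E\<^esub>) \<and> (\<lambda>x. (x, f x)) ` A \<subseteq> G}"
  have ZD: "G \<subseteq> carrier B \<times> carrier E"
      "\<And>x y x' y'. (x, y) \<in> G \<Longrightarrow> (x', y') \<in> G \<Longrightarrow> (x \<oplus>\<^bsub>B\<^esub> x', y \<oplus>\<^bsub>E\<^esub> y') \<in> G"
      "\<And>x y r. (x, y) \<in> G \<Longrightarrow> r \<in> carrier R \<Longrightarrow> (x \<odot>\<^sub>r\<^bsub>B\<^esub> r, y \<odot>\<^sub>r\<^bsub>E\<^esub> r) \<in> G"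
      "\<And>y. (\<zero>\<^bsub>B\<^esub>, y) \<in> G \<Longrightarrow> y = \<zero>\<^bsub>E\<^esub>"
      "(\<lambda>x. (x, f x)) ` A \<subseteq> G" if "G \<in> Z" for G
    using that unfolding Z_def mem_Collect_eq by metis+
  have f_in: "f x \<in> carrier E" if "x \<in> A" for x using f that by (auto simp: rmod_hom_def)
  have f_add: "f (x \<oplus>\<^bsub>B\<^esub> y) = f x \<oplus>\<^bsub>E\<^esub> f y" if "x \<in> A" "y \<in> A" for x y
    using f that by (auto simp: rmod_hom_def)
  have f_sm: "f (x \<odot>\<^sub>r\<^bsub>B\<^esub> r) = f x \<odot>\<^sub>r\<^bsub>E\<^esub> r" if "x \<in> A" "r \<in> carrier R" for x r
    using f that by (auto simp: rmod_hom_def)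
  have f0: "f \<zero>\<^bsub>B\<^esub> = \<zero>\<^bsub>E\<^esub>"
    using f_sm[of "\<zero>\<^bsub>B\<^esub>" "\<zero>\<^bsub>R\<^esub>"] submod_zero[OF A] f_in
    by (simp add: B.zero_rsmult E.rsmult_zero)
  have "(\<lambda>x. (x, f x)) ` A \<in> Z"
    using A submod_subset[OF A] unfolding Z_def
    by (auto simp: f_in f_add f_sm f0 image_iff submod_add submod_rsmult)
  then have "Z \<noteq> {}" by blast
  moreover have "\<Union>C \<in> Z" if "C \<noteq> {}" "subset.chain Z C" for C
  proof -
    have sub: "C \<subseteq> Z" and tot: "\<And>G H. G \<in> C \<Longrightarrow> H \<in> C \<Longrightarrow> G \<subseteq> H \<or> H \<subseteq> G"
      using that(2) by (auto simp: subset.chain_def subset_chain_def)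
    have "(x \<oplus>\<^bsub>B\<^esub> x', y \<oplus>\<^bsub>E\<^esub> y') \<in> \<Union>C" if "(x, y) \<in> \<Union>C" "(x', y') \<in> \<Union>C" for x y x' y'
    proof -
      obtain G where "G \<in> C" "(x, y) \<in> G" "(x', y') \<in> G" using \<open>(x, y) \<in> \<Union>C\<close> \<open>(x', y') \<in> \<Union>C\<close> tot by blast
      moreover have "G \<in> Z" using sub \<open>G \<in> C\<close> by blast
      ultimately show ?thesis using ZD(2) by (meson UnionI)
    qed
    moreover have "\<Union>C \<subseteq> carrier B \<times> carrier E"
      using sub ZD(1) by blast
    moreover have "(x \<odot>\<^sub>r\<^bsub>B\<^esub> r, y \<odot>\<^sub>r\<^bsub>E\<^esub> r) \<in> \<Union>C" if "(x, y) \<in> \<Union>C" "r \<in> carrier R" for x y r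
      using sub that ZD(3) by (meson UnionE UnionI subsetD)
    moreover have "y = \<zero>\<^bsub>E\<^esub>" if "(\<zero>\<^bsub>B\<^esub>, y) \<in> \<Union>C" for y
      using sub that ZD(4) by (meson UnionE subsetD)
    moreover have "(\<lambda>x. (x, f x)) ` A \<subseteq> \<Union>C"
      using sub \<open>C \<noteq> {}\<close> ZD(5) by (meson Sup_upper ex_in_conv order_trans subsetD)
    ultimately show ?thesis unfolding Z_def mem_Collect_eq by (intro conjI allI impI)
  qed
  ultimately obtain G where GZ: "G \<in> Z" and Gmax: "\<And>H. H \<in> Z \<Longrightarrow> G \<subseteq> H \<Longrightarrow> H = G"
    using subset_Zorn_nonempty[of Z] by blast
  have G_in: "x \<in> carrier B" "y \<in> carrier E" if "(x, y) \<in> G" for x y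
    using ZD(1)[OF GZ] that by blast+
  have G_add: "(x \<oplus>\<^bsub>B\<^esub> x', y \<oplus>\<^bsub>E\<^esub> y') \<in> G" if "(x, y) \<in> G" "(x', y') \<in> G" for x y x' y'
    using ZD(2)[OF GZ] that by blast
  have G_sm: "(x \<odot>\<^sub>r\<^bsub>B\<^esub> r, y \<odot>\<^sub>r\<^bsub>E\<^esub> r) \<in> G" if "(x, y) \<in> G" "r \<in> carrier R" for x y r
    using ZD(3)[OF GZ] that by blast
  have G_0: "y = \<zero>\<^bsub>E\<^esub>" if "(\<zero>\<^bsub>B\<^esub>, y) \<in> G" for y
    using ZD(4)[OF GZ] that by blast
  have G_f: "(x, f x) \<in> G" if "x \<in> A" for x
    using ZD(5)[OF GZ] that by blast
  have G_00: "(\<zero>\<^bsub>B\<^esub>, \<zero>\<^bsub>E\<^esub>) \<in> G" using G_f[OF submod_zero[OF A]] by (simp add: f0)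
  have G_neg: "(\<ominus>\<^bsub>B\<^esub> x, \<ominus>\<^bsub>E\<^esub> y) \<in> G" if "(x, y) \<in> G" for x y
    using G_sm[OF that, of "\<ominus>\<^bsub>R\<^esub> \<one>\<^bsub>R\<^esub>"] G_in[OF that]
    by (simp add: B.rsmult_minus_one E.rsmult_minus_one)
  have G_fun: "y = y'" if "(x, y) \<in> G" "(x, y') \<in> G" for x y y'
  proof -
    have "(x \<oplus>\<^bsub>B\<^esub> \<ominus>\<^bsub>B\<^esub> x, y \<oplus>\<^bsub>E\<^esub> \<ominus>\<^bsub>E\<^esub> y') \<in> G" using that by (intro G_add G_neg)
    then have "y \<oplus>\<^bsub>E\<^esub> \<ominus>\<^bsub>E\<^esub> y' = \<zero>\<^bsub>E\<^esub>" using G_in[OF that(1)] by (auto simp: B.M.r_neg intro: G_0)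
    thus ?thesis using G_in[OF that(1)] G_in[OF that(2)]
      by (metis E.M.minus_equality E.M.minus_minus E.M.add.inv_closed)
  qed
  have dom: "\<exists>y. (b, y) \<in> G" if b: "b \<in> carrier B" for b
  proof -
    define I where "I = {r \<in> carrier R. \<exists>y. (b \<odot>\<^sub>r\<^bsub>B\<^esub> r, y) \<in> G}"
    define h where "h = (\<lambda>r\<in>I. THE y. (b \<odot>\<^sub>r\<^bsub>B\<^esub> r, y) \<in> G)"
    have h: "h r = y" if "r \<in> carrier R" "(b \<odot>\<^sub>r\<^bsub>B\<^esub> r, y) \<in> G" for r y
      using that G_fun unfolding h_def I_def by (auto intro!: the_equality)
    have hI: "(b \<odot>\<^sub>r\<^bsub>B\<^esub> r, h r) \<in> G" "r \<in> carrier R" if "r \<in> I" for r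
      using that h unfolding I_def by auto
    interpret RR: right_module R "right_regular R"
      by (rule right_module_right_regular) (rule E.ring_axioms)
    have plus: "(b \<odot>\<^sub>r\<^bsub>B\<^esub> (r \<oplus>\<^bsub>R\<^esub> s), h r \<oplus>\<^bsub>E\<^esub> h s) \<in> G" if "r \<in> I" "s \<in> I" for r s
      using G_add[OF hI(1)[OF that(1)] hI(1)[OF that(2)]] hI(2) that
      by (simp add: B.rsmult_r_distr b)
    have times: "(b \<odot>\<^sub>r\<^bsub>B\<^esub> (r \<otimes>\<^bsub>R\<^esub> s), h r \<odot>\<^sub>r\<^bsub>E\<^esub> s) \<in> G" if "r \<in> I" "s \<in> carrier R" for r s
      using G_sm[OF hI(1)[OF that(1)] that(2)] hI(2) that by (simp add: B.rsmult_assoc b)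
    have clos: "r \<oplus>\<^bsub>R\<^esub> s \<in> I" if "r \<in> I" "s \<in> I" for r s
      using plus[OF that] hI(2) that by (auto simp: I_def)
    have closm: "r \<otimes>\<^bsub>R\<^esub> s \<in> I" if "r \<in> I" "s \<in> carrier R" for r s
      using times[OF that] hI(2) that by (auto simp: I_def)
    have "submod R (right_regular R) I"
    proof (rule RR.submodI)
      show "I \<subseteq> carrier (right_regular R)" by (auto simp: right_regular_def I_def)
      show "\<zero>\<^bsub>right_regular R\<^esub> \<in> I"
        using G_00 by (auto simp: right_regular_def I_def B.rsmult_zero b)
    qed (use clos closm in \<open>auto simp: right_regular_def\<close>)
    moreover have "h \<in> rmod_hom R ((right_regular R)\<lparr>carrier := I\<rparr>) E"
      unfolding rmod_hom_def
    proof (intro CollectI conjI ballI)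
      show "h \<in> carrier ((right_regular R)\<lparr>carrier := I\<rparr>) \<rightarrow>\<^sub>E carrier E"
        using G_in(2)[OF hI(1)] by (auto simp: h_def)
      show "h (r \<oplus>\<^bsub>(right_regular R)\<lparr>carrier := I\<rparr>\<^esub> s) = h r \<oplus>\<^bsub>E\<^esub> h s"
        if "r \<in> carrier ((right_regular R)\<lparr>carrier := I\<rparr>)" "s \<in> carrier ((right_regular R)\<lparr>carrier := I\<rparr>)"
        for r s
        using that plus[of r s] clos[of r s] hI(2) by (auto simp: right_regular_def intro!: h)
      show "h (r \<odot>\<^sub>r\<^bsub>(right_regular R)\<lparr>carrier := I\<rparr>\<^esub> s) = h r \<odot>\<^sub>r\<^bsub>E\<^esub> s"
        if "r \<in> carrier ((right_regular R)\<lparr>carrier := I\<rparr>)" "s \<in> carrier R" for r s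
        using that times[of r s] closm[of r s] hI(2) by (auto simp: right_regular_def intro!: h)
    qed
    ultimately obtain k where k: "k \<in> rmod_hom R (right_regular R) E" and kh: "\<And>r. r \<in> I \<Longrightarrow> k r = h r"
      using inj RR.right_module_axioms unfolding injective_rmodule_def injective_for_def by blast
    define e where "e = k \<one>\<^bsub>R\<^esub>"
    have e: "e \<in> carrier E" using k by (auto simp: e_def rmod_hom_def right_regular_def)
    have k_e: "k r = e \<odot>\<^sub>r\<^bsub>E\<^esub> r" if r: "r \<in> carrier R" for r
    proof -
      have "k (\<one>\<^bsub>R\<^esub> \<otimes>\<^bsub>R\<^esub> r) = k \<one>\<^bsub>R\<^esub> \<odot>\<^sub>r\<^bsub>E\<^esub> r"
        using k r by (simp add: rmod_hom_def right_regular_def del: E.l_one)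
      thus ?thesis using r by (simp add: e_def)
    qed
    define H where "H = {(x \<oplus>\<^bsub>B\<^esub> b \<odot>\<^sub>r\<^bsub>B\<^esub> r, y \<oplus>\<^bsub>E\<^esub> e \<odot>\<^sub>r\<^bsub>E\<^esub> r) | x y r. (x, y) \<in> G \<and> r \<in> carrier R}"
    have HI: "(u, v) \<in> H"
      if "(x, y) \<in> G" "r \<in> carrier R" "u = x \<oplus>\<^bsub>B\<^esub> b \<odot>\<^sub>r\<^bsub>B\<^esub> r" "v = y \<oplus>\<^bsub>E\<^esub> e \<odot>\<^sub>r\<^bsub>E\<^esub> r" for x y r u v
      using that unfolding H_def by blast
    have HE: "\<exists>x y r. (x, y) \<in> G \<and> r \<in> carrier R \<and> u = x \<oplus>\<^bsub>B\<^esub> b \<odot>\<^sub>r\<^bsub>B\<^esub> r \<and> v = y \<oplus>\<^bsub>E\<^esub> e \<odot>\<^sub>r\<^bsub>E\<^esub> r"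
      if "(u, v) \<in> H" for u v
      using that unfolding H_def by blast
    have GH: "G \<subseteq> H"
    proof clarify
      fix x y assume "(x, y) \<in> G"
      then show "(x, y) \<in> H"
        by (intro HI[of x y "\<zero>\<^bsub>R\<^esub>"]) (auto simp: b e B.rsmult_zero E.rsmult_zero G_in)
    qed
    have beH: "(b, e) \<in> H"
      by (rule HI[OF G_00, of "\<one>\<^bsub>R\<^esub>"]) (auto simp: b e B.rsmult_one E.rsmult_one)
    have "H \<in> Z"
      unfolding Z_def
    proof (intro CollectI conjI allI impI)
      show "H \<subseteq> carrier B \<times> carrier E"
        by (auto simp: H_def b e G_in B.rsmult_closed E.rsmult_closed)
      show "(\<lambda>x. (x, f x)) ` A \<subseteq> H" using G_f GH by blast
    next
      fix u v u' v' assume "(u, v) \<in> H" "(u', v') \<in> H"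
      then obtain x y r x' y' r' where
        *: "(x, y) \<in> G" "r \<in> carrier R" "u = x \<oplus>\<^bsub>B\<^esub> b \<odot>\<^sub>r\<^bsub>B\<^esub> r" "v = y \<oplus>\<^bsub>E\<^esub> e \<odot>\<^sub>r\<^bsub>E\<^esub> r"
           "(x', y') \<in> G" "r' \<in> carrier R" "u' = x' \<oplus>\<^bsub>B\<^esub> b \<odot>\<^sub>r\<^bsub>B\<^esub> r'" "v' = y' \<oplus>\<^bsub>E\<^esub> e \<odot>\<^sub>r\<^bsub>E\<^esub> r'"
        using HE by meson
      show "(u \<oplus>\<^bsub>B\<^esub> u', v \<oplus>\<^bsub>E\<^esub> v') \<in> H"
        using * G_in[OF *(1)] G_in[OF *(5)] b e
        by (intro HI[OF G_add[OF *(1,5)], of "r \<oplus>\<^bsub>R\<^esub> r'"])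
           (auto simp: B.rsmult_r_distr E.rsmult_r_distr B.rsmult_closed E.rsmult_closed
              B.M.a_ac E.M.a_ac)
    next
      fix u v s assume "(u, v) \<in> H" "s \<in> carrier R"
      then obtain x y r where
        *: "(x, y) \<in> G" "r \<in> carrier R" "u = x \<oplus>\<^bsub>B\<^esub> b \<odot>\<^sub>r\<^bsub>B\<^esub> r" "v = y \<oplus>\<^bsub>E\<^esub> e \<odot>\<^sub>r\<^bsub>E\<^esub> r"
        using HE by meson
      show "(u \<odot>\<^sub>r\<^bsub>B\<^esub> s, v \<odot>\<^sub>r\<^bsub>E\<^esub> s) \<in> H"
        using * G_in[OF *(1)] b e \<open>s \<in> carrier R\<close>
        by (intro HI[OF G_sm[OF *(1) \<open>s \<in> carrier R\<close>], of "r \<otimes>\<^bsub>R\<^esub> s"])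
           (auto simp: B.rsmult_l_distr E.rsmult_l_distr B.rsmult_closed E.rsmult_closed
              B.rsmult_assoc E.rsmult_assoc)
    next
      fix v assume "(\<zero>\<^bsub>B\<^esub>, v) \<in> H"
      then obtain x y r where
        *: "(x, y) \<in> G" "r \<in> carrier R" "\<zero>\<^bsub>B\<^esub> = x \<oplus>\<^bsub>B\<^esub> b \<odot>\<^sub>r\<^bsub>B\<^esub> r" "v = y \<oplus>\<^bsub>E\<^esub> e \<odot>\<^sub>r\<^bsub>E\<^esub> r"
        using HE by meson
      note c = G_in[OF *(1)] B.rsmult_closed[OF b *(2)] E.rsmult_closed[OF e *(2)]
      have "b \<odot>\<^sub>r\<^bsub>B\<^esub> r = \<ominus>\<^bsub>B\<^esub> x"
        using c *(3) by (metis B.M.minus_equality B.M.a_comm)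
      then have m: "(b \<odot>\<^sub>r\<^bsub>B\<^esub> r, \<ominus>\<^bsub>E\<^esub> y) \<in> G" using G_neg[OF *(1)] by simp
      then have "r \<in> I" using *(2) by (auto simp: I_def)
      then have "e \<odot>\<^sub>r\<^bsub>E\<^esub> r = \<ominus>\<^bsub>E\<^esub> y" using kh k_e[OF *(2)] h[OF *(2) m] by simp
      then show "v = \<zero>\<^bsub>E\<^esub>" using *(4) c by (simp add: E.M.r_neg)
    qed
    then show ?thesis using Gmax GH beH by blast
  qed
  define g where "g = (\<lambda>x\<in>carrier B. THE y. (x, y) \<in> G)"
  have g: "g x = y" if "(x, y) \<in> G" for x y
    using that G_fun G_in(1)[OF that] unfolding g_def by (auto intro!: the_equality)
  have gG: "(x, g x) \<in> G" if "x \<in> carrier B" for x using dom[OF that] g by auto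
  have "g \<in> rmod_hom R B E"
    unfolding rmod_hom_def
  proof (intro CollectI conjI ballI)
    show "g \<in> carrier B \<rightarrow>\<^sub>E carrier E" using gG G_in(2) by (auto simp: g_def)
  qed (auto intro!: g G_add G_sm gG)
  moreover have "\<forall>x\<in>A. g x = f x" using G_f g by blast
  ultimately show "\<exists>g\<in>rmod_hom R B E. \<forall>x\<in>A. g x = f x" by blast
qed

end

theory Submission
  imports Defs
begin

text \<open>
  For an injective module \<open>E\<close> and two-sided ideals \<open>P\<close> and \<open>Q\<close>, the non-vanishing of
  \<open>Ext\<^sup>1(R/P, ann\<^sub>E(Q))\<close> is an elementwise condition on \<open>E\<close>. Since \<open>E\<close> is injective, an
  extension class comes from a homomorphism from \<open>R/P\<close> to \<open>E / ann\<^sub>E(Q)\<close>, that is, from some \<open>x\<close> with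
  \<open>x P Q = 0\<close>, and it is trivial iff \<open>x \<in> ann\<^sub>E(P) + ann\<^sub>E(Q)\<close>. Injectivity also identifies this sum
  with \<open>ann\<^sub>E(P \<inter> Q)\<close>. Hence the group is nonzero iff some \<open>x \<in> E\<close> satisfies \<open>x P Q = 0\<close> and
  \<open>x (P \<inter> Q) \<noteq> 0\<close>; this is \<open>Ext1_factor_ann_iff\<close>.

  It remains to carry such an \<open>x\<close> from \<open>E\<^sub>Q\<close> to \<open>E\<close>. Every homomorphism \<open>G\<close> from \<open>E\<^sub>Q\<close> to \<open>E\<close>
  preserves \<open>x P Q = 0\<close>, so it is enough to find one with \<open>G (x b) \<noteq> 0\<close>, where \<open>b \<in> P \<inter> Q\<close> and
  \<open>x b \<noteq> 0\<close>. By \<open>is_EQ_separated_by_homs\<close>, homomorphisms to \<open>E\<close> separate every nonzero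
  element of \<open>E\<^sub>Q\<close> from \<open>0\<close>. Indeed, a right ideal of \<open>R/Q\<close> is essential in \<open>E\<^sub>Q\<close>, so every nonzero element of \<open>E\<^sub>Q\<close>
  has a nonzero multiple in it, which is a coset \<open>Q + a\<close> with \<open>a \<notin> Q\<close>. As \<open>Q\<close> is exactly the
  annihilator of some submodule of \<open>E\<close>, that submodule has an element \<open>c\<close> with \<open>c a \<noteq> 0\<close>, and
  \<open>Q + a r \<mapsto> c a r\<close> is a well-defined homomorphism, which injectivity extends to all of \<open>E\<^sub>Q\<close>.
\<close>

section \<open>Modules and homomorphisms\<close>

lemma (in right_module) minus_rsmult:
  assumes "x \<in> carrier M" "r \<in> carrier R"
  shows "(\<ominus>\<^bsub>M\<^esub> x) \<odot>\<^sub>r\<^bsub>M\<^esub> r = \<ominus>\<^bsub>M\<^esub> (x \<odot>\<^sub>r\<^bsub>M\<^esub> r)"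
proof -
  have "(\<ominus>\<^bsub>M\<^esub> x) \<odot>\<^sub>r\<^bsub>M\<^esub> r \<oplus>\<^bsub>M\<^esub> x \<odot>\<^sub>r\<^bsub>M\<^esub> r = \<zero>\<^bsub>M\<^esub>"
    using assms by (simp add: rsmult_l_distr[symmetric] M.l_neg zero_rsmult)
  then show ?thesis using assms by (simp add: M.minus_equality rsmult_closed)
qed

lemma rmod_hom_closed: "f \<in> rmod_hom R M N \<Longrightarrow> x \<in> carrier M \<Longrightarrow> f x \<in> carrier N"
  by (auto simp: rmod_hom_def)

lemma rmod_hom_add:
  "f \<in> rmod_hom R M N \<Longrightarrow> x \<in> carrier M \<Longrightarrow> y \<in> carrier M \<Longrightarrow> f (x \<oplus>\<^bsub>M\<^esub> y) = f x \<oplus>\<^bsub>N\<^esub> f y"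
  by (auto simp: rmod_hom_def)

lemma rmod_hom_rsmult:
  "f \<in> rmod_hom R M N \<Longrightarrow> x \<in> carrier M \<Longrightarrow> r \<in> carrier R
    \<Longrightarrow> f (x \<odot>\<^sub>r\<^bsub>M\<^esub> r) = f x \<odot>\<^sub>r\<^bsub>N\<^esub> r"
  by (auto simp: rmod_hom_def)

lemma rmod_hom_eqI:
  assumes "f \<in> rmod_hom R M N" "g \<in> rmod_hom R M N" "\<And>x. x \<in> carrier M \<Longrightarrow> f x = g x"
  shows "f = g"
  using assms by (intro extensionalityI[of f "carrier M" g]) (auto simp: rmod_hom_def PiE_def)

lemma (in right_module) restrict_rmod_homI:
  assumes "\<And>x. x \<in> carrier M \<Longrightarrow> f x \<in> carrier N"
    and "\<And>x y. x \<in> carrier M \<Longrightarrow> y \<in> carrier M \<Longrightarrow> f (x \<oplus>\<^bsub>M\<^esub> y) = f x \<oplus>\<^bsub>N\<^esub> f y"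
    and "\<And>x r. x \<in> carrier M \<Longrightarrow> r \<in> carrier R \<Longrightarrow> f (x \<odot>\<^sub>r\<^bsub>M\<^esub> r) = f x \<odot>\<^sub>r\<^bsub>N\<^esub> r"
  shows "(\<lambda>x\<in>carrier M. f x) \<in> rmod_hom R M N"
  using assms by (auto simp: rmod_hom_def rsmult_closed)

lemma rmod_hom_zero:
  assumes "right_module R M" "right_module R N" "f \<in> rmod_hom R M N"
  shows "f \<zero>\<^bsub>M\<^esub> = \<zero>\<^bsub>N\<^esub>"
proof -
  interpret M: right_module R M by fact
  interpret N: right_module R N by fact
  show ?thesis
    using rmod_hom_rsmult[OF assms(3), of "\<zero>\<^bsub>M\<^esub>" "\<zero>\<^bsub>R\<^esub>"] rmod_hom_closed[OF assms(3), of "\<zero>\<^bsub>M\<^esub>"]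
    by (simp add: M.zero_rsmult N.rsmult_zero)
qed

lemma rmod_hom_neg:
  assumes "right_module R M" "right_module R N" "f \<in> rmod_hom R M N" "x \<in> carrier M"
  shows "f (\<ominus>\<^bsub>M\<^esub> x) = \<ominus>\<^bsub>N\<^esub> f x"
proof -
  interpret M: right_module R M by fact
  interpret N: right_module R N by fact
  show ?thesis
    using rmod_hom_rsmult[OF assms(3,4), of "\<ominus>\<^bsub>R\<^esub> \<one>\<^bsub>R\<^esub>"] rmod_hom_closed[OF assms(3,4)] assms(4)
    by (simp add: M.rsmult_minus_one N.rsmult_minus_one)
qed

lemma compose_rmod_hom:
  assumes "right_module R M" "f \<in> rmod_hom R M N" "g \<in> rmod_hom R N L"
  shows "compose (carrier M) g f \<in> rmod_hom R M L"
proof -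
  interpret M: right_module R M by fact
  show ?thesis unfolding compose_def
    using assms(2,3)
    by (intro M.restrict_rmod_homI) (auto simp: rmod_hom_closed rmod_hom_add rmod_hom_rsmult)
qed

lemma submod_neg:
  assumes "right_module R M" "submod R M N" "x \<in> N"
  shows "\<ominus>\<^bsub>M\<^esub> x \<in> N"
proof -
  interpret right_module R M by fact
  show ?thesis
    using submod_rsmult[OF assms(2,3), of "\<ominus>\<^bsub>R\<^esub> \<one>\<^bsub>R\<^esub>"] submod_subset[OF assms(2)] assms(3)
    by (auto simp: rsmult_minus_one)
qed

lemma right_module_submod:
  assumes "right_module R M" "submod R M N"
  shows "right_module R (M\<lparr>carrier := N\<rparr>)"
proof -
  interpret right_module R M by fact
  have N: "x \<in> carrier M" if "x \<in> N" for x using submod_subset[OF assms(2)] that by blast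
  have "abelian_group (M\<lparr>carrier := N\<rparr>)"
  proof (rule abelian_groupI)
    show "\<exists>y\<in>carrier (M\<lparr>carrier := N\<rparr>). y \<oplus>\<^bsub>M\<lparr>carrier := N\<rparr>\<^esub> x = \<zero>\<^bsub>M\<lparr>carrier := N\<rparr>\<^esub>"
      if "x \<in> carrier (M\<lparr>carrier := N\<rparr>)" for x
      using that by (intro bexI[of _ "\<ominus>\<^bsub>M\<^esub> x"]) (auto simp: M.l_neg N submod_neg[OF assms])
  qed (auto simp: submod_add[OF assms(2)] submod_zero[OF assms(2)] N M.a_ac)
  then show ?thesis
    by (intro right_module.intro right_module_axioms.intro)
       (auto simp: N submod_rsmult[OF assms(2)] rsmult_l_distr rsmult_r_distr rsmult_assoc rsmult_one
          R.ring_axioms)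
qed

lemma submod_kernel:
  assumes "right_module R M" "right_module R N" "f \<in> rmod_hom R M N"
  shows "submod R M (a_kernel M N f)"
proof -
  interpret M: right_module R M by fact
  interpret N: right_module R N by fact
  show ?thesis
    by (rule M.submodI)
       (auto simp: a_kernel_def kernel_def rmod_hom_zero[OF assms] rmod_hom_add[OF assms(3)]
          rmod_hom_rsmult[OF assms(3)] M.rsmult_closed N.zero_rsmult)
qed

lemma (in right_module) finsum_in_submod:
  assumes "submod R M N" "\<And>s. s \<in> T \<Longrightarrow> f s \<in> N"
  shows "finsum M f T \<in> N"
proof (cases "finite T")
  case True
  from True assms(2) show ?thesis
  proof (induction T)
    case empty
    show ?case using submod_zero[OF assms(1)] by simp
  next
    case (insert s T)
    have "f \<in> T \<rightarrow> carrier M" "f s \<in> carrier M"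
      using insert.prems submod_subset[OF assms(1)] by auto
    then show ?case using insert by (simp add: submod_add[OF assms(1)])
  qed
next
  case False
  then show ?thesis using submod_zero[OF assms(1)] by (simp add: M.add.finprod_infinite)
qed

lemma (in right_module) finsum_rsmult:
  assumes "finite T" "\<And>s. s \<in> T \<Longrightarrow> f s \<in> carrier M" "r \<in> carrier R"
  shows "finsum M f T \<odot>\<^sub>r\<^bsub>M\<^esub> r = finsum M (\<lambda>s. f s \<odot>\<^sub>r\<^bsub>M\<^esub> r) T"
  using assms(1,2)
proof (induction T)
  case empty
  then show ?case using assms(3) by (simp add: zero_rsmult)
next
  case (insert s T)
  have "f \<in> T \<rightarrow> carrier M" "f s \<in> carrier M" "(\<lambda>s. f s \<odot>\<^sub>r\<^bsub>M\<^esub> r) \<in> T \<rightarrow> carrier M"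
    using insert.prems assms(3) by (auto intro: rsmult_closed)
  then show ?case using insert assms(3) by (simp add: rsmult_l_distr M.finsum_closed rsmult_closed)
qed

lemma rmod_hom_finsum:
  assumes "right_module R M" "right_module R N" "f \<in> rmod_hom R M N"
    and "finite T" "\<And>s. s \<in> T \<Longrightarrow> t s \<in> carrier M"
  shows "f (finsum M t T) = finsum N (\<lambda>s. f (t s)) T"
proof -
  interpret M: right_module R M by fact
  interpret N: right_module R N by fact
  show ?thesis
    using assms(4,5)
  proof (induction T)
    case empty
    then show ?case by (simp add: rmod_hom_zero[OF assms(1-3)])
  next
    case (insert s T)
    have "t \<in> T \<rightarrow> carrier M" "t s \<in> carrier M" using insert.prems by auto
    moreover from this have "(\<lambda>s. f (t s)) \<in> T \<rightarrow> carrier N" "f (t s) \<in> carrier N"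
      by (auto intro: rmod_hom_closed[OF assms(3)])
    ultimately show ?case
      using insert by (simp add: rmod_hom_add[OF assms(3)])
  qed
qed

lemma injective_rmodule_right_module: "injective_rmodule R E \<Longrightarrow> right_module R E"
  by (simp add: injective_rmodule_def injective_for_def)

text \<open>
  The extension property in the form in which it is applied: a homomorphism on a submodule is
  given by its graph \<open>G\<close>, so that it can be prescribed by non-unique expressions for its
  arguments. That \<open>G\<close> is single-valued then only has to be checked at \<open>0\<close>.
\<close>

lemma injective_rmodule_extend_graph:
  fixes M :: "('r, 'm) rmodule"
  assumes inj: "injective_rmodule R E" and "right_module R M"
    and sub: "G \<subseteq> carrier M \<times> carrier E" and zero: "(\<zero>\<^bsub>M\<^esub>, \<zero>\<^bsub>E\<^esub>) \<in> G"
    and add: "\<And>x y x' y'. (x, y) \<in> G \<Longrightarrow> (x', y') \<in> G \<Longrightarrow> (x \<oplus>\<^bsub>M\<^esub> x', y \<oplus>\<^bsub>E\<^esub> y') \<in> G"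
    and smult: "\<And>x y r. (x, y) \<in> G \<Longrightarrow> r \<in> carrier R \<Longrightarrow> (x \<odot>\<^sub>r\<^bsub>M\<^esub> r, y \<odot>\<^sub>r\<^bsub>E\<^esub> r) \<in> G"
    and single: "\<And>y. (\<zero>\<^bsub>M\<^esub>, y) \<in> G \<Longrightarrow> y = \<zero>\<^bsub>E\<^esub>"
  obtains h where "h \<in> rmod_hom R M E" "\<And>x y. (x, y) \<in> G \<Longrightarrow> h x = y"
proof -
  interpret M: right_module R M by fact
  interpret E: right_module R E using inj by (rule injective_rmodule_right_module)
  have car: "x \<in> carrier M" "y \<in> carrier E" if "(x, y) \<in> G" for x y using sub that by auto
  have neg: "(\<ominus>\<^bsub>M\<^esub> x, \<ominus>\<^bsub>E\<^esub> y) \<in> G" if "(x, y) \<in> G" for x y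
    using smult[OF that, of "\<ominus>\<^bsub>R\<^esub> \<one>\<^bsub>R\<^esub>"] car[OF that]
    by (simp add: M.rsmult_minus_one E.rsmult_minus_one)
  have fun_G: "y = y'" if "(x, y) \<in> G" "(x, y') \<in> G" for x y y'
  proof -
    have "(x \<oplus>\<^bsub>M\<^esub> \<ominus>\<^bsub>M\<^esub> x, y \<oplus>\<^bsub>E\<^esub> \<ominus>\<^bsub>E\<^esub> y') \<in> G" using that by (intro add neg)
    then have "y \<oplus>\<^bsub>E\<^esub> \<ominus>\<^bsub>E\<^esub> y' = \<zero>\<^bsub>E\<^esub>" using car[OF that(1)] by (auto simp: M.M.r_neg intro: single)
    then show ?thesis using car[OF that(1)] car[OF that(2)]
      by (metis E.M.minus_equality E.M.minus_minus E.M.add.inv_closed)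
  qed
  define D where "D = Domain G"
  define g where "g = (\<lambda>x\<in>D. THE y. (x, y) \<in> G)"
  have g: "g x = y" if "(x, y) \<in> G" for x y
    using that fun_G unfolding g_def D_def by (auto intro!: the_equality)
  have gG: "(x, g x) \<in> G" if "x \<in> D" for x using that g unfolding D_def by auto
  have D: "submod R M D"
    by (rule M.submodI) (use sub zero in \<open>auto simp: D_def intro: add smult\<close>)
  have "g \<in> extensional D" by (simp add: g_def)
  then have "g \<in> rmod_hom R (M\<lparr>carrier := D\<rparr>) E"
    unfolding rmod_hom_def
    using gG car(2)[OF gG] by (auto simp: PiE_def intro!: g add smult)
  moreover have "injective_for TYPE('m) R E"
    using inj by (rule injective_rmodule_imp_injective_for)
  ultimately obtain h where "h \<in> rmod_hom R M E" "\<forall>x\<in>D. h x = g x"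
    using D M.right_module_axioms unfolding injective_for_def by blast
  then show thesis using that g unfolding D_def by (metis Domain.DomainI)
qed

text \<open>
  The annihilator condition says that \<open>w r \<mapsto> e r\<close> is well defined on the cyclic submodule \<open>w R\<close>.
\<close>

lemma injective_rmodule_extend_cyclic:
  assumes inj: "injective_rmodule R E" and "right_module R M"
    and w: "w \<in> carrier M" and e: "e \<in> carrier E"
    and ann: "\<And>r. r \<in> carrier R \<Longrightarrow> w \<odot>\<^sub>r\<^bsub>M\<^esub> r = \<zero>\<^bsub>M\<^esub> \<Longrightarrow> e \<odot>\<^sub>r\<^bsub>E\<^esub> r = \<zero>\<^bsub>E\<^esub>"
  obtains h where "h \<in> rmod_hom R M E" "h w = e"
proof -
  interpret M: right_module R M by fact
  interpret E: right_module R E using inj by (rule injective_rmodule_right_module)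
  define G where "G = (\<lambda>r. (w \<odot>\<^sub>r\<^bsub>M\<^esub> r, e \<odot>\<^sub>r\<^bsub>E\<^esub> r)) ` carrier R"
  have GI: "(w \<odot>\<^sub>r\<^bsub>M\<^esub> r, e \<odot>\<^sub>r\<^bsub>E\<^esub> r) \<in> G" if "r \<in> carrier R" for r using that by (auto simp: G_def)
  obtain h where "h \<in> rmod_hom R M E" and h: "\<And>x y. (x, y) \<in> G \<Longrightarrow> h x = y"
  proof (rule injective_rmodule_extend_graph[OF inj assms(2), of G])
    show "G \<subseteq> carrier M \<times> carrier E" using w e by (auto simp: G_def M.rsmult_closed E.rsmult_closed)
    show "(\<zero>\<^bsub>M\<^esub>, \<zero>\<^bsub>E\<^esub>) \<in> G" using GI[of "\<zero>\<^bsub>R\<^esub>"] w e by (simp add: M.rsmult_zero E.rsmult_zero)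
    show "(x \<oplus>\<^bsub>M\<^esub> x', y \<oplus>\<^bsub>E\<^esub> y') \<in> G" if G: "(x, y) \<in> G" "(x', y') \<in> G" for x y x' y'
    proof -
      obtain r r' where "r \<in> carrier R" "x = w \<odot>\<^sub>r\<^bsub>M\<^esub> r" "y = e \<odot>\<^sub>r\<^bsub>E\<^esub> r"
          "r' \<in> carrier R" "x' = w \<odot>\<^sub>r\<^bsub>M\<^esub> r'" "y' = e \<odot>\<^sub>r\<^bsub>E\<^esub> r'"
        using G by (auto simp: G_def)
      then show ?thesis using GI[of "r \<oplus>\<^bsub>R\<^esub> r'"] w e by (simp add: M.rsmult_r_distr E.rsmult_r_distr)
    qed
    show "(x \<odot>\<^sub>r\<^bsub>M\<^esub> s, y \<odot>\<^sub>r\<^bsub>E\<^esub> s) \<in> G" if G: "(x, y) \<in> G" and s: "s \<in> carrier R" for x y s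
    proof -
      obtain r where "r \<in> carrier R" "x = w \<odot>\<^sub>r\<^bsub>M\<^esub> r" "y = e \<odot>\<^sub>r\<^bsub>E\<^esub> r" using G by (auto simp: G_def)
      then show ?thesis using GI[of "r \<otimes>\<^bsub>R\<^esub> s"] w e s by (simp add: M.rsmult_assoc E.rsmult_assoc)
    qed
    show "y = \<zero>\<^bsub>E\<^esub>" if "(\<zero>\<^bsub>M\<^esub>, y) \<in> G" for y using that ann by (auto simp: G_def)
  qed blast
  then show thesis
    using that[of h] h[OF GI[of "\<one>\<^bsub>R\<^esub>"]] w e by (simp add: M.rsmult_one E.rsmult_one)
qed

section \<open>Free modules\<close>

definition free_basis :: "('r, 'x) ring_scheme \<Rightarrow> 's \<Rightarrow> 's \<Rightarrow> 'r" where
  "free_basis R s = (\<lambda>t. if t = s then \<one>\<^bsub>R\<^esub> else \<zero>\<^bsub>R\<^esub>)"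

text \<open>
  The homomorphism given by \<open>u\<close> on the basis. The map \<^const>\<open>free_map\<close> is the case where \<open>u\<close> is
  the inclusion of \<open>S\<close>; a general \<open>u\<close> is needed to lift the augmentation of the resolution of
  \<open>R/P\<close> along the projection from \<open>R\<close>.
\<close>

definition free_lift ::
  "('r, 'x) ring_scheme \<Rightarrow> ('r, 'm) rmodule \<Rightarrow> 's set \<Rightarrow> ('s \<Rightarrow> 'm) \<Rightarrow> ('s \<Rightarrow> 'r) \<Rightarrow> 'm" where
  "free_lift R M S u = (\<lambda>c\<in>carrier (free_rmodule R S).
     finsum M (\<lambda>s. u s \<odot>\<^sub>r\<^bsub>M\<^esub> c s) {s \<in> S. c s \<noteq> \<zero>\<^bsub>R\<^esub>})"

lemma free_map_eq_free_lift: "free_map R M S = free_lift R M S (\<lambda>s. s)"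
  by (simp add: free_map_def free_lift_def)

lemma right_module_free_rmodule:
  assumes "ring R"
  shows "right_module R (free_rmodule R S)"
proof -
  interpret ring R by fact
  let ?F = "free_rmodule R S"
  have fin: "finite {s. c s \<oplus>\<^bsub>R\<^esub> d s \<noteq> \<zero>\<^bsub>R\<^esub>}" if "c \<in> carrier ?F" "d \<in> carrier ?F" for c d
    by (rule finite_subset[of _ "{s. c s \<noteq> \<zero>\<^bsub>R\<^esub>} \<union> {s. d s \<noteq> \<zero>\<^bsub>R\<^esub>}"])
       (use that in \<open>auto simp: free_rmodule_def\<close>)
  have fin_smult: "finite {s. c s \<otimes>\<^bsub>R\<^esub> r \<noteq> \<zero>\<^bsub>R\<^esub>}" if "c \<in> carrier ?F" "r \<in> carrier R" for c r
    by (rule finite_subset[of _ "{s. c s \<noteq> \<zero>\<^bsub>R\<^esub>}"]) (use that in \<open>auto simp: free_rmodule_def\<close>)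
  have in_R: "c s \<in> carrier R" if "c \<in> carrier ?F" for c s
    using that by (cases "s \<in> S") (auto simp: free_rmodule_def)
  have "abelian_group ?F"
  proof (rule abelian_groupI)
    show "\<exists>d\<in>carrier ?F. d \<oplus>\<^bsub>?F\<^esub> c = \<zero>\<^bsub>?F\<^esub>" if c: "c \<in> carrier ?F" for c
    proof (rule bexI[of _ "\<lambda>s. c s \<otimes>\<^bsub>R\<^esub> (\<ominus>\<^bsub>R\<^esub> \<one>\<^bsub>R\<^esub>)"])
      show "(\<lambda>s. c s \<otimes>\<^bsub>R\<^esub> (\<ominus>\<^bsub>R\<^esub> \<one>\<^bsub>R\<^esub>)) \<oplus>\<^bsub>?F\<^esub> c = \<zero>\<^bsub>?F\<^esub>"
        using in_R[OF c] by (auto simp: free_rmodule_def r_minus l_neg)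
      show "(\<lambda>s. c s \<otimes>\<^bsub>R\<^esub> (\<ominus>\<^bsub>R\<^esub> \<one>\<^bsub>R\<^esub>)) \<in> carrier ?F"
        using c fin_smult[OF c, of "\<ominus>\<^bsub>R\<^esub> \<one>\<^bsub>R\<^esub>"] by (auto simp: free_rmodule_def)
    qed
    show "c \<oplus>\<^bsub>?F\<^esub> d \<in> carrier ?F" if "c \<in> carrier ?F" "d \<in> carrier ?F" for c d
      using that fin[OF that] by (auto simp: free_rmodule_def)
    show "c \<oplus>\<^bsub>?F\<^esub> d \<oplus>\<^bsub>?F\<^esub> e = c \<oplus>\<^bsub>?F\<^esub> (d \<oplus>\<^bsub>?F\<^esub> e)"
      if "c \<in> carrier ?F" "d \<in> carrier ?F" "e \<in> carrier ?F" for c d e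
      using that[THEN in_R] by (auto simp: free_rmodule_def a_assoc)
    show "c \<oplus>\<^bsub>?F\<^esub> d = d \<oplus>\<^bsub>?F\<^esub> c" if "c \<in> carrier ?F" "d \<in> carrier ?F" for c d
      using that[THEN in_R] by (auto simp: free_rmodule_def a_comm)
    show "\<zero>\<^bsub>?F\<^esub> \<oplus>\<^bsub>?F\<^esub> c = c" if "c \<in> carrier ?F" for c
      using that[THEN in_R] by (auto simp: free_rmodule_def)
  qed (auto simp: free_rmodule_def)
  moreover have "c \<odot>\<^sub>r\<^bsub>?F\<^esub> r \<in> carrier ?F" if "c \<in> carrier ?F" "r \<in> carrier R" for c r
    using that fin_smult[OF that] by (auto simp: free_rmodule_def)
  moreover have "(c \<oplus>\<^bsub>?F\<^esub> d) \<odot>\<^sub>r\<^bsub>?F\<^esub> r = c \<odot>\<^sub>r\<^bsub>?F\<^esub> r \<oplus>\<^bsub>?F\<^esub> d \<odot>\<^sub>r\<^bsub>?F\<^esub> r"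
    if "c \<in> carrier ?F" "d \<in> carrier ?F" "r \<in> carrier R" for c d r
    using that(1,2)[THEN in_R] that(3) by (auto simp: free_rmodule_def l_distr)
  moreover have "c \<odot>\<^sub>r\<^bsub>?F\<^esub> (r \<oplus>\<^bsub>R\<^esub> s) = c \<odot>\<^sub>r\<^bsub>?F\<^esub> r \<oplus>\<^bsub>?F\<^esub> c \<odot>\<^sub>r\<^bsub>?F\<^esub> s"
      "c \<odot>\<^sub>r\<^bsub>?F\<^esub> (r \<otimes>\<^bsub>R\<^esub> s) = (c \<odot>\<^sub>r\<^bsub>?F\<^esub> r) \<odot>\<^sub>r\<^bsub>?F\<^esub> s"
    if "c \<in> carrier ?F" "r \<in> carrier R" "s \<in> carrier R" for c r s
    using that(1)[THEN in_R] that(2,3) by (auto simp: free_rmodule_def r_distr m_assoc)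
  moreover have "c \<odot>\<^sub>r\<^bsub>?F\<^esub> \<one>\<^bsub>R\<^esub> = c" if "c \<in> carrier ?F" for c
    using that[THEN in_R] by (auto simp: free_rmodule_def)
  ultimately show ?thesis
    by (intro right_module.intro right_module_axioms.intro ring_axioms)
qed

lemma free_basis_in_free_rmodule:
  assumes "ring R" "s \<in> S"
  shows "free_basis R s \<in> carrier (free_rmodule R S)"
proof -
  interpret ring R by fact
  have "finite {t. free_basis R s t \<noteq> \<zero>\<^bsub>R\<^esub>}"
    by (rule finite_subset[of _ "{s}"]) (auto simp: free_basis_def)
  then show ?thesis using assms(2) by (auto simp: free_rmodule_def free_basis_def)
qed

text \<open>
  The sum in \<^const>\<open>free_lift\<close> runs over the support of \<open>c\<close>, which varies with \<open>c\<close>. Additivity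
  requires sums for different \<open>c\<close> over a common index set.
\<close>

lemma (in right_module) free_lift_eq_finsum:
  assumes u: "\<And>s. s \<in> S \<Longrightarrow> u s \<in> carrier M" and c: "c \<in> carrier (free_rmodule R S)"
    and T: "finite T" "T \<subseteq> S" "\<And>s. s \<in> S \<Longrightarrow> c s \<noteq> \<zero> \<Longrightarrow> s \<in> T"
  shows "free_lift R M S u c = finsum M (\<lambda>s. u s \<odot>\<^sub>r\<^bsub>M\<^esub> c s) T"
proof -
  have cR: "c s \<in> carrier R" if "s \<in> S" for s using c that by (auto simp: free_rmodule_def)
  have "finsum M (\<lambda>s. u s \<odot>\<^sub>r\<^bsub>M\<^esub> c s) {s \<in> S. c s \<noteq> \<zero>} = finsum M (\<lambda>s. u s \<odot>\<^sub>r\<^bsub>M\<^esub> c s) T"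
    by (rule M.add.finprod_mono_neutral_cong_left)
       (use T u cR in \<open>auto simp: rsmult_zero subset_iff intro!: rsmult_closed\<close>)
  then show ?thesis using c by (simp add: free_lift_def)
qed

lemma (in right_module) free_lift_basis:
  assumes "\<And>s. s \<in> S \<Longrightarrow> u s \<in> carrier M" "s \<in> S"
  shows "free_lift R M S u (free_basis R s) = u s"
proof -
  have "free_lift R M S u (free_basis R s) = finsum M (\<lambda>t. u t \<odot>\<^sub>r\<^bsub>M\<^esub> free_basis R s t) {s}"
    by (rule free_lift_eq_finsum)
       (use assms free_basis_in_free_rmodule[OF R.ring_axioms] in \<open>auto simp: free_basis_def split: if_splits\<close>)
  then show ?thesis using assms by (simp add: free_basis_def rsmult_one)
qed

lemma (in right_module) free_lift_hom:
  assumes u: "\<And>s. s \<in> S \<Longrightarrow> u s \<in> carrier M"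
  shows "free_lift R M S u \<in> rmod_hom R (free_rmodule R S) M"
proof -
  let ?F = "free_rmodule R S" and ?supp = "\<lambda>c. {s \<in> S. c s \<noteq> \<zero>}"
  interpret F: right_module R ?F by (rule right_module_free_rmodule) (rule R.ring_axioms)
  have cR: "c s \<in> carrier R" if "c \<in> carrier ?F" "s \<in> S" for c s
    using that by (auto simp: free_rmodule_def)
  have fin: "finite (?supp c)" if "c \<in> carrier ?F" for c
    using that by (auto simp: free_rmodule_def)
  have lift: "free_lift R M S u c = finsum M (\<lambda>s. u s \<odot>\<^sub>r\<^bsub>M\<^esub> c s) T"
    if "c \<in> carrier ?F" "finite T" "T \<subseteq> S" "?supp c \<subseteq> T" for c T
    by (rule free_lift_eq_finsum) (use u that in auto)
  have "free_lift R M S u c \<in> carrier M" if c: "c \<in> carrier ?F" for c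
    using c by (auto simp: free_lift_def cR u intro!: M.finsum_closed rsmult_closed)
  moreover have "free_lift R M S u (c \<oplus>\<^bsub>?F\<^esub> d) = free_lift R M S u c \<oplus>\<^bsub>M\<^esub> free_lift R M S u d"
    if c: "c \<in> carrier ?F" and d: "d \<in> carrier ?F" for c d
  proof -
    define T where "T = ?supp c \<union> ?supp d"
    have T: "finite T" "T \<subseteq> S" using fin[OF c] fin[OF d] by (auto simp: T_def)
    have sum: "(c \<oplus>\<^bsub>?F\<^esub> d) s = c s \<oplus> d s" for s by (simp add: free_rmodule_def)
    have "free_lift R M S u (c \<oplus>\<^bsub>?F\<^esub> d) = finsum M (\<lambda>s. u s \<odot>\<^sub>r\<^bsub>M\<^esub> (c \<oplus>\<^bsub>?F\<^esub> d) s) T"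
      by (rule lift[OF _ T]) (use c d in \<open>auto simp: T_def sum\<close>)
    also have "\<dots> = finsum M (\<lambda>s. u s \<odot>\<^sub>r\<^bsub>M\<^esub> c s \<oplus>\<^bsub>M\<^esub> u s \<odot>\<^sub>r\<^bsub>M\<^esub> d s) T"
      by (rule M.finsum_cong')
         (use T(2) c d in \<open>auto simp: sum subset_iff u cR rsmult_r_distr intro!: rsmult_closed M.add.m_closed\<close>)
    also have "\<dots> = finsum M (\<lambda>s. u s \<odot>\<^sub>r\<^bsub>M\<^esub> c s) T \<oplus>\<^bsub>M\<^esub> finsum M (\<lambda>s. u s \<odot>\<^sub>r\<^bsub>M\<^esub> d s) T"
      by (rule M.finsum_addf) (use T(2) c d in \<open>auto simp: subset_iff u cR intro!: rsmult_closed\<close>)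
    also have "\<dots> = free_lift R M S u c \<oplus>\<^bsub>M\<^esub> free_lift R M S u d"
      by (subst (1 2) lift[OF _ T]) (use c d in \<open>auto simp: T_def\<close>)
    finally show ?thesis .
  qed
  moreover have "free_lift R M S u (c \<odot>\<^sub>r\<^bsub>?F\<^esub> r) = free_lift R M S u c \<odot>\<^sub>r\<^bsub>M\<^esub> r"
    if c: "c \<in> carrier ?F" and r: "r \<in> carrier R" for c r
  proof -
    have T: "finite (?supp c)" "?supp c \<subseteq> S" using fin[OF c] by auto
    have sm: "(c \<odot>\<^sub>r\<^bsub>?F\<^esub> r) s = c s \<otimes> r" for s by (simp add: free_rmodule_def)
    have "free_lift R M S u (c \<odot>\<^sub>r\<^bsub>?F\<^esub> r) = finsum M (\<lambda>s. u s \<odot>\<^sub>r\<^bsub>M\<^esub> (c \<odot>\<^sub>r\<^bsub>?F\<^esub> r) s) (?supp c)"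
      by (rule lift[OF _ T]) (use c r in \<open>auto simp: sm F.rsmult_closed\<close>)
    also have "\<dots> = finsum M (\<lambda>s. (u s \<odot>\<^sub>r\<^bsub>M\<^esub> c s) \<odot>\<^sub>r\<^bsub>M\<^esub> r) (?supp c)"
      by (rule M.finsum_cong')
         (use c r in \<open>auto simp: sm u cR rsmult_assoc intro!: rsmult_closed\<close>)
    also have "\<dots> = finsum M (\<lambda>s. u s \<odot>\<^sub>r\<^bsub>M\<^esub> c s) (?supp c) \<odot>\<^sub>r\<^bsub>M\<^esub> r"
      by (rule finsum_rsmult[symmetric]) (use T(1) c r in \<open>auto simp: u cR intro!: rsmult_closed\<close>)
    also have "\<dots> = free_lift R M S u c \<odot>\<^sub>r\<^bsub>M\<^esub> r"
      by (subst lift[OF c T]) auto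
    finally show ?thesis .
  qed
  ultimately show ?thesis by (auto simp: rmod_hom_def free_lift_def)
qed

lemma rmod_hom_free_lift:
  assumes "right_module R M" "right_module R N" "f \<in> rmod_hom R M N"
    and u: "\<And>s. s \<in> S \<Longrightarrow> u s \<in> carrier M" and v: "\<And>s. s \<in> S \<Longrightarrow> f (u s) = v s"
    and c: "c \<in> carrier (free_rmodule R S)"
  shows "f (free_lift R M S u c) = free_lift R N S v c"
proof -
  interpret M: right_module R M by fact
  interpret N: right_module R N by fact
  let ?T = "{s \<in> S. c s \<noteq> \<zero>\<^bsub>R\<^esub>}"
  have cR: "c s \<in> carrier R" if "s \<in> S" for s using c that by (auto simp: free_rmodule_def)
  have "f (free_lift R M S u c) = finsum N (\<lambda>s. f (u s \<odot>\<^sub>r\<^bsub>M\<^esub> c s)) ?T"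
    using c u cR
    by (auto simp: free_lift_def free_rmodule_def M.rsmult_closed
        intro!: rmod_hom_finsum[OF assms(1-3)])
  also have "\<dots> = finsum N (\<lambda>s. v s \<odot>\<^sub>r\<^bsub>N\<^esub> c s) ?T"
    using u cR by (intro N.M.finsum_cong')
      (auto simp: rmod_hom_rsmult[OF assms(3)] v[symmetric]
        intro!: N.rsmult_closed rmod_hom_closed[OF assms(3)])
  finally show ?thesis using c by (simp add: free_lift_def)
qed

text \<open>
  If the basis \<open>S\<close> is a whole submodule, the image is exactly \<open>S\<close>. This is the exactness of the
  standard resolution, whose terms are free on the kernels of the preceding maps.
\<close>

lemma (in right_module) free_map_hom:
  assumes "submod R M S"
  shows "free_map R M S \<in> rmod_hom R (free_rmodule R S) M"
    and "free_map R M S \<in> rmod_hom R (free_rmodule R S) (M\<lparr>carrier := S\<rparr>)"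
    and "s \<in> S \<Longrightarrow> free_map R M S (free_basis R s) = s"
proof -
  have S: "s \<in> carrier M" if "s \<in> S" for s using that submod_subset[OF assms] by blast
  show hom: "free_map R M S \<in> rmod_hom R (free_rmodule R S) M"
    unfolding free_map_eq_free_lift by (rule free_lift_hom) (rule S)
  have "free_map R M S c \<in> S" if "c \<in> carrier (free_rmodule R S)" for c
    using that
    by (auto simp: free_map_def free_rmodule_def intro!: finsum_in_submod[OF assms] submod_rsmult[OF assms])
  then show "free_map R M S \<in> rmod_hom R (free_rmodule R S) (M\<lparr>carrier := S\<rparr>)"
    using hom by (auto simp: rmod_hom_def PiE_def)
  show "free_map R M S (free_basis R s) = s" if "s \<in> S"
    unfolding free_map_eq_free_lift by (rule free_lift_basis) (use S that in auto)
qed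

section \<open>The first Ext group as an extension problem\<close>

lemma group_Hom_group:
  assumes "right_module R M" "right_module R N"
  shows "group (Hom_group R M N)"
proof -
  interpret M: right_module R M by fact
  interpret N: right_module R N by fact
  note hom = rmod_hom_closed rmod_hom_add rmod_hom_rsmult
  let ?H = "Hom_group R M N"
  have simps: "carrier ?H = rmod_hom R M N" "\<one>\<^bsub>?H\<^esub> = (\<lambda>x\<in>carrier M. \<zero>\<^bsub>N\<^esub>)"
      "f \<otimes>\<^bsub>?H\<^esub> g = (\<lambda>x\<in>carrier M. f x \<oplus>\<^bsub>N\<^esub> g x)" for f g
    by (auto simp: Hom_group_def)
  have closed: "f \<otimes>\<^bsub>?H\<^esub> g \<in> carrier ?H" if "f \<in> carrier ?H" "g \<in> carrier ?H" for f g
    unfolding simps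
    by (rule M.restrict_rmod_homI)
       (use that in \<open>auto simp: simps hom N.M.a_ac N.rsmult_l_distr\<close>)
  have one: "\<one>\<^bsub>?H\<^esub> \<in> carrier ?H"
    unfolding simps by (rule M.restrict_rmod_homI) (auto simp: N.zero_rsmult)
  show ?thesis
  proof (rule groupI)
    fix f assume f: "f \<in> carrier ?H"
    show "\<one>\<^bsub>?H\<^esub> \<otimes>\<^bsub>?H\<^esub> f = f"
      by (rule rmod_hom_eqI[of _ R M N])
         (use f closed[OF one f] in \<open>auto simp: simps hom\<close>)
    have "(\<lambda>x\<in>carrier M. \<ominus>\<^bsub>N\<^esub> f x) \<in> carrier ?H"
      unfolding simps
      by (rule M.restrict_rmod_homI)
         (use f in \<open>auto simp: simps hom N.M.minus_add N.rsmult_closed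
            N.minus_rsmult\<close>)
    moreover have "(\<lambda>x\<in>carrier M. \<ominus>\<^bsub>N\<^esub> f x) \<otimes>\<^bsub>?H\<^esub> f = \<one>\<^bsub>?H\<^esub>"
      using f by (auto simp: simps hom N.M.l_neg)
    ultimately show "\<exists>g\<in>carrier ?H. g \<otimes>\<^bsub>?H\<^esub> f = \<one>\<^bsub>?H\<^esub>" by blast
  next
    fix f g h assume "f \<in> carrier ?H" "g \<in> carrier ?H" "h \<in> carrier ?H"
    then show "f \<otimes>\<^bsub>?H\<^esub> g \<otimes>\<^bsub>?H\<^esub> h = f \<otimes>\<^bsub>?H\<^esub> (g \<otimes>\<^bsub>?H\<^esub> h)"
      by (auto simp: simps hom N.M.a_assoc)
  qed (fact closed one)+
qed

lemma compose_hom_Hom_group: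
  assumes "right_module R L" "d \<in> rmod_hom R L M"
  shows "(\<lambda>f. compose (carrier L) f d) \<in> hom (Hom_group R M N) (Hom_group R L N)"
  using compose_rmod_hom[OF assms] rmod_hom_closed[OF assms(2)]
  by (auto simp: hom_def Hom_group_def compose_def)

text \<open>
  Meant for the cocycles \<open>K\<close> and the coboundaries \<open>H\<close> among the cochains \<open>G\<close>: a cohomology group
  is nonzero iff some cocycle is not a coboundary.
\<close>

lemma (in group) carrier_Mod_restricted_nontrivial_iff:
  assumes H: "subgroup H G" and K: "K \<subseteq> carrier G" "\<one> \<in> K"
  shows "carrier (G\<lparr>carrier := K\<rparr> Mod H) \<noteq> {\<one>\<^bsub>G\<lparr>carrier := K\<rparr> Mod H\<^esub>} \<longleftrightarrow> \<not> K \<subseteq> H"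
proof -
  have "carrier (G\<lparr>carrier := K\<rparr> Mod H) = (\<lambda>a. H #> a) ` K"
    by (auto simp: FactGroup_def RCOSETS_def r_coset_def)
  moreover have "H #> a = H \<longleftrightarrow> a \<in> H" if "a \<in> K" for a
    using coset_join1[OF _ _ H] coset_join2[OF _ H] K that subgroup.subset[OF H] by blast
  then have "(\<lambda>a. H #> a) ` K = {H} \<longleftrightarrow> K \<subseteq> H" using K(2) by blast
  ultimately show ?thesis by (simp add: FactGroup_def)
qed

text \<open>
  From \<open>0 \<rightarrow> K \<rightarrow> F\<^sub>0 \<rightarrow> A \<rightarrow> 0\<close> with \<open>F\<^sub>0\<close> free, \<open>Ext\<^sup>1(A, B)\<close> is the cokernel of the restriction
  from \<open>Hom(F\<^sub>0, B)\<close> to \<open>Hom(K, B)\<close>. In terms of the resolution, a cocycle on \<open>F\<^sub>1\<close> vanishes on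
  the kernel \<open>L\<close> of \<open>F\<^sub>1 \<rightarrow> F\<^sub>0\<close>, because \<open>F\<^sub>2\<close> maps onto \<open>L\<close>; so it factors through the image \<open>K\<close>,
  and it is a coboundary iff the induced map extends to \<open>F\<^sub>0\<close>.
\<close>

lemma Ext1_nonzero_iff:
  assumes A: "right_module R A" and B: "right_module R B"
  defines "K \<equiv> a_kernel (res_F0 R A) A (res_aug R A)"
  shows "Ext1_nonzero R A B \<longleftrightarrow>
    (\<exists>g \<in> rmod_hom R ((res_F0 R A)\<lparr>carrier := K\<rparr>) B.
       \<not> (\<exists>h \<in> rmod_hom R (res_F0 R A) B. \<forall>k\<in>K. h k = g k))"
proof -
  interpret A: right_module R A by fact
  interpret B: right_module R B by fact
  define F0 where "F0 = res_F0 R A"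
  define F1 where "F1 = res_F1 R A"
  define F2 where "F2 = res_F2 R A"
  define d1 where "d1 = res_d1 R A"
  define d2 where "d2 = res_d2 R A"
  interpret F0: right_module R F0
    unfolding F0_def res_F0_def by (rule right_module_free_rmodule) (rule A.ring_axioms)
  interpret F1: right_module R F1
    unfolding F1_def res_F1_def by (rule right_module_free_rmodule) (rule A.ring_axioms)
  interpret F2: right_module R F2
    unfolding F2_def res_F2_def by (rule right_module_free_rmodule) (rule A.ring_axioms)
  have "submod R A (carrier A)"
    by (rule A.submodI) (auto simp: A.rsmult_closed)
  then have aug: "res_aug R A \<in> rmod_hom R F0 A"
    unfolding F0_def res_F0_def res_aug_def by (rule A.free_map_hom)
  have K: "submod R F0 K"
    unfolding K_def F0_def[symmetric]
    by (rule submod_kernel[OF F0.right_module_axioms A aug])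
  have F1: "F1 = free_rmodule R K" and d1_eq: "d1 = free_map R F0 K"
    by (simp_all add: F1_def res_F1_def d1_def res_d1_def K_def F0_def)
  have d1: "d1 \<in> rmod_hom R F1 F0" and d1_K: "d1 \<in> rmod_hom R F1 (F0\<lparr>carrier := K\<rparr>)"
    and d1_basis: "\<And>k. k \<in> K \<Longrightarrow> d1 (free_basis R k) = k"
    unfolding F1 d1_eq using F0.free_map_hom[OF K] by blast+
  have basis1: "free_basis R k \<in> carrier F1" if "k \<in> K" for k
    unfolding F1 using that by (rule free_basis_in_free_rmodule[OF A.ring_axioms])
  define L where "L = a_kernel F1 F0 d1"
  have L_iff: "c \<in> L \<longleftrightarrow> c \<in> carrier F1 \<and> d1 c = \<zero>\<^bsub>F0\<^esub>" for c
    by (auto simp: L_def a_kernel_def kernel_def)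
  have L: "submod R F1 L"
    unfolding L_def by (rule submod_kernel[OF F1.right_module_axioms F0.right_module_axioms d1])
  have F2: "F2 = free_rmodule R L" and d2_eq: "d2 = free_map R F1 L"
    by (simp_all add: F2_def res_F2_def d2_def res_d2_def L_def F1_def F0_def d1_def)
  have d2: "d2 \<in> rmod_hom R F2 F1" and d2_L: "d2 \<in> rmod_hom R F2 (F1\<lparr>carrier := L\<rparr>)"
    and d2_basis: "\<And>c. c \<in> L \<Longrightarrow> d2 (free_basis R c) = c"
    unfolding F2 d2_eq using F1.free_map_hom[OF L] by blast+
  have basis2: "free_basis R c \<in> carrier F2" if "c \<in> L" for c
    unfolding F2 using that by (rule free_basis_in_free_rmodule[OF A.ring_axioms])

  let ?H0 = "Hom_group R F0 B" and ?H1 = "Hom_group R F1 B" and ?H2 = "Hom_group R F2 B"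
  let ?D1 = "\<lambda>f. compose (carrier F1) f d1" and ?D2 = "\<lambda>f. compose (carrier F2) f d2"
  have H_car: "carrier ?H0 = rmod_hom R F0 B" "carrier ?H1 = rmod_hom R F1 B"
    by (simp_all add: Hom_group_def)
  interpret H0: group ?H0 by (rule group_Hom_group[OF F0.right_module_axioms B])
  interpret H1: group ?H1 by (rule group_Hom_group[OF F1.right_module_axioms B])
  interpret H2: group ?H2 by (rule group_Hom_group[OF F2.right_module_axioms B])
  interpret D1: group_hom ?H0 ?H1 ?D1
    by (intro group_hom.intro group_hom_axioms.intro H0.group_axioms H1.group_axioms
          compose_hom_Hom_group[OF F1.right_module_axioms d1])
  interpret D2: group_hom ?H1 ?H2 ?D2
    by (intro group_hom.intro group_hom_axioms.intro H1.group_axioms H2.group_axioms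
          compose_hom_Hom_group[OF F2.right_module_axioms d2])
  have cocycle_iff: "f \<in> kernel ?H1 ?H2 ?D2 \<longleftrightarrow> f \<in> rmod_hom R F1 B \<and> (\<forall>c\<in>L. f c = \<zero>\<^bsub>B\<^esub>)" for f
  proof -
    have "?D2 f = \<one>\<^bsub>?H2\<^esub> \<longleftrightarrow> (\<forall>c\<in>carrier F2. f (d2 c) = \<zero>\<^bsub>B\<^esub>)"
      by (auto simp: Hom_group_def compose_def fun_eq_iff restrict_def)
    also have "\<dots> \<longleftrightarrow> (\<forall>c\<in>L. f c = \<zero>\<^bsub>B\<^esub>)"
      using rmod_hom_closed[OF d2_L] d2_basis basis2 by fastforce
    finally show ?thesis by (simp add: kernel_def H_car)
  qed
  have "Ext1_nonzero R A B \<longleftrightarrow> \<not> kernel ?H1 ?H2 ?D2 \<subseteq> ?D1 ` carrier ?H0"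
    unfolding Ext1_nonzero_def Ext1_def F0_def[symmetric] F1_def[symmetric] F2_def[symmetric]
      d1_def[symmetric] d2_def[symmetric]
    by (rule H1.carrier_Mod_restricted_nontrivial_iff[OF D1.img_is_subgroup])
       (auto simp: kernel_def)
  also have "\<dots> \<longleftrightarrow> (\<exists>f \<in> rmod_hom R F1 B. (\<forall>c\<in>L. f c = \<zero>\<^bsub>B\<^esub>) \<and>
      \<not> (\<exists>h \<in> rmod_hom R F0 B. f = ?D1 h))"
    by (auto simp: subset_iff cocycle_iff H_car)
  also have "\<dots> \<longleftrightarrow> (\<exists>g \<in> rmod_hom R (F0\<lparr>carrier := K\<rparr>) B.
      \<not> (\<exists>h \<in> rmod_hom R F0 B. \<forall>k\<in>K. h k = g k))"
  proof
    assume "\<exists>f \<in> rmod_hom R F1 B. (\<forall>c\<in>L. f c = \<zero>\<^bsub>B\<^esub>) \<and> \<not> (\<exists>h \<in> rmod_hom R F0 B. f = ?D1 h)"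
    then obtain f where f: "f \<in> rmod_hom R F1 B" and f_L: "\<And>c. c \<in> L \<Longrightarrow> f c = \<zero>\<^bsub>B\<^esub>"
      and not_bd: "\<And>h. h \<in> rmod_hom R F0 B \<Longrightarrow> f \<noteq> ?D1 h" by blast
    \<comment> \<open>\<open>f\<close> factors through \<open>d1\<close>; on \<open>K\<close> the factor sends \<open>k\<close> to the value of \<open>f\<close> at the basis
      element over \<open>k\<close>.\<close>
    have f_cong: "f c = f c'" if c: "c \<in> carrier F1" "c' \<in> carrier F1" "d1 c = d1 c'" for c c'
    proof -
      have "c \<oplus>\<^bsub>F1\<^esub> \<ominus>\<^bsub>F1\<^esub> c' \<in> L"
        using c rmod_hom_closed[OF d1]
        by (simp add: L_iff rmod_hom_add[OF d1]
            rmod_hom_neg[OF F1.right_module_axioms F0.right_module_axioms d1] F0.M.r_neg)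
      then have "f c \<oplus>\<^bsub>B\<^esub> \<ominus>\<^bsub>B\<^esub> f c' = \<zero>\<^bsub>B\<^esub>"
        using f_L c by (metis F1.M.a_inv_closed rmod_hom_add[OF f] rmod_hom_neg[OF F1.right_module_axioms B f])
      then show ?thesis
        using c rmod_hom_closed[OF f] by (metis B.M.minus_equality B.M.minus_minus B.M.a_inv_closed)
    qed
    interpret K: right_module R "F0\<lparr>carrier := K\<rparr>"
      by (rule right_module_submod[OF F0.right_module_axioms K])
    define g where "g = (\<lambda>k\<in>carrier (F0\<lparr>carrier := K\<rparr>). f (free_basis R k))"
    have g_d1: "f (free_basis R (d1 c)) = f c" if "c \<in> carrier F1" for c
      using rmod_hom_closed[OF d1_K that] that by (intro f_cong) (auto simp: basis1 d1_basis)
    have "g \<in> rmod_hom R (F0\<lparr>carrier := K\<rparr>) B"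
      unfolding g_def
    proof (rule K.restrict_rmod_homI)
      show "f (free_basis R k) \<in> carrier B" if "k \<in> carrier (F0\<lparr>carrier := K\<rparr>)" for k
        using that basis1 rmod_hom_closed[OF f] by simp
      show "f (free_basis R (k \<oplus>\<^bsub>F0\<lparr>carrier := K\<rparr>\<^esub> k')) = f (free_basis R k) \<oplus>\<^bsub>B\<^esub> f (free_basis R k')"
        if "k \<in> carrier (F0\<lparr>carrier := K\<rparr>)" "k' \<in> carrier (F0\<lparr>carrier := K\<rparr>)" for k k'
        using that basis1 d1_basis g_d1[of "free_basis R k \<oplus>\<^bsub>F1\<^esub> free_basis R k'"]
        by (simp add: rmod_hom_add[OF d1] rmod_hom_add[OF f])
      show "f (free_basis R (k \<odot>\<^sub>r\<^bsub>F0\<lparr>carrier := K\<rparr>\<^esub> r)) = f (free_basis R k) \<odot>\<^sub>r\<^bsub>B\<^esub> r"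
        if "k \<in> carrier (F0\<lparr>carrier := K\<rparr>)" "r \<in> carrier R" for k r
        using that basis1 d1_basis g_d1[of "free_basis R k \<odot>\<^sub>r\<^bsub>F1\<^esub> r"]
        by (simp add: rmod_hom_rsmult[OF d1] rmod_hom_rsmult[OF f] F1.rsmult_closed)
    qed
    moreover have "\<not> (\<exists>h \<in> rmod_hom R F0 B. \<forall>k\<in>K. h k = g k)"
    proof
      assume "\<exists>h \<in> rmod_hom R F0 B. \<forall>k\<in>K. h k = g k"
      then obtain h where h: "h \<in> rmod_hom R F0 B" and hg: "\<And>k. k \<in> K \<Longrightarrow> h k = g k" by blast
      have "f = ?D1 h"
      proof (rule rmod_hom_eqI[OF f compose_rmod_hom[OF F1.right_module_axioms d1 h]])
        fix c assume c: "c \<in> carrier F1"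
        then have "d1 c \<in> K" using rmod_hom_closed[OF d1_K] by simp
        then show "f c = ?D1 h c" using c g_d1[OF c] by (simp add: compose_def hg g_def)
      qed
      then show False using not_bd[OF h] by contradiction
    qed
    ultimately show "\<exists>g \<in> rmod_hom R (F0\<lparr>carrier := K\<rparr>) B.
      \<not> (\<exists>h \<in> rmod_hom R F0 B. \<forall>k\<in>K. h k = g k)" by blast
  next
    assume "\<exists>g \<in> rmod_hom R (F0\<lparr>carrier := K\<rparr>) B. \<not> (\<exists>h \<in> rmod_hom R F0 B. \<forall>k\<in>K. h k = g k)"
    then obtain g where g: "g \<in> rmod_hom R (F0\<lparr>carrier := K\<rparr>) B"
      and no_ext: "\<And>h. h \<in> rmod_hom R F0 B \<Longrightarrow> \<exists>k\<in>K. h k \<noteq> g k" by blast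
    have "g \<zero>\<^bsub>F0\<^esub> = \<zero>\<^bsub>B\<^esub>"
      using rmod_hom_zero[OF right_module_submod[OF F0.right_module_axioms K] B g] by simp
    then have "\<forall>c\<in>L. ?D1 g c = \<zero>\<^bsub>B\<^esub>" by (simp add: L_iff compose_def)
    moreover have "?D1 g \<noteq> ?D1 h" if h: "h \<in> rmod_hom R F0 B" for h
    proof
      assume eq: "?D1 g = ?D1 h"
      obtain k where k: "k \<in> K" "h k \<noteq> g k" using no_ext[OF h] by blast
      have "?D1 g (free_basis R k) = ?D1 h (free_basis R k)" using eq by simp
      then show False using k by (simp add: compose_def basis1 d1_basis)
    qed
    ultimately show "\<exists>f \<in> rmod_hom R F1 B. (\<forall>c\<in>L. f c = \<zero>\<^bsub>B\<^esub>) \<and>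
      \<not> (\<exists>h \<in> rmod_hom R F0 B. f = ?D1 h)"
      using compose_rmod_hom[OF F1.right_module_axioms d1_K g] by blast
  qed
  finally show ?thesis unfolding F0_def .
qed

section \<open>Ext from a factor ring to the annihilator of an ideal in an injective module\<close>

lemma factor_rmodule_coset_iff:
  assumes "ideal I R" "a \<in> carrier R"
  shows "I +>\<^bsub>R\<^esub> a = \<zero>\<^bsub>factor_rmodule R I\<^esub> \<longleftrightarrow> a \<in> I"
proof -
  have "\<zero>\<^bsub>factor_rmodule R I\<^esub> = I" by (simp add: factor_rmodule_def FactRing_def)
  then show ?thesis
    using ideal.rcos_const_imp_mem[OF assms] ring.a_rcos_zero[OF ideal.axioms(2)[OF assms(1)] assms(1)]
    by metis
qed

lemma factor_rmodule_coset_rsmult: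
  assumes "ideal I R" "a \<in> carrier R" "r \<in> carrier R"
  shows "(I +>\<^bsub>R\<^esub> a) \<odot>\<^sub>r\<^bsub>factor_rmodule R I\<^esub> r = I +>\<^bsub>R\<^esub> (a \<otimes>\<^bsub>R\<^esub> r)"
  using ring_hom_mult[OF ideal.rcos_ring_hom[OF assms(1)] assms(2,3)]
  by (simp add: factor_rmodule_def)

lemma factor_rmodule_coset_closed:
  assumes "ideal I R" "a \<in> carrier R"
  shows "I +>\<^bsub>R\<^esub> a \<in> carrier (factor_rmodule R I)"
  using ring_hom_closed[OF ideal.rcos_ring_hom[OF assms(1)] assms(2)]
  by (simp add: factor_rmodule_def)

lemma factor_rmodule_cases:
  assumes "X \<in> carrier (factor_rmodule R I)"
  obtains a where "a \<in> carrier R" "X = I +>\<^bsub>R\<^esub> a"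
  using assms that by (auto simp: factor_rmodule_def FactRing_def A_RCOSETS_def')

lemma right_module_factor_rmodule:
  assumes "ideal I R"
  shows "right_module R (factor_rmodule R I)"
proof -
  interpret ideal I R by fact
  interpret S: ring "R Quot I" by (rule quotient_is_ring)
  note hom = rcos_ring_hom
  have "abelian_group (factor_rmodule R I)"
    by (rule abelian_groupI) (auto simp: factor_rmodule_def S.a_ac intro: S.l_neg)
  then show ?thesis
    by (intro right_module.intro right_module_axioms.intro ideal.axioms(2)[OF assms])
       (auto simp: factor_rmodule_def ring_hom_closed[OF hom] ring_hom_add[OF hom]
          ring_hom_mult[OF hom] ring_hom_one[OF hom] S.l_distr S.r_distr S.m_assoc)
qed

lemma submod_ann_in:
  assumes "right_module R M" "ideal Q R"
  shows "submod R M (ann_in M Q)"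
proof -
  interpret right_module R M by fact
  interpret Q: ideal Q R by fact
  show ?thesis
    by (rule submodI)
       (auto simp: ann_in_def zero_rsmult rsmult_l_distr rsmult_closed Q.Icarr rsmult_assoc[symmetric]
          Q.I_l_closed)
qed

text \<open>
  This is \<open>ann\<^sub>E(P \<inter> Q) \<subseteq> ann\<^sub>E(P) + ann\<^sub>E(Q)\<close>: since \<open>x\<close> kills \<open>P \<inter> Q\<close>, the map
  \<open>p + q \<mapsto> x q\<close> is well defined on \<open>P + Q\<close>, and injectivity extends it to \<open>R\<close>, where it is
  multiplication by some \<open>z \<in> E\<close>. Then \<open>z\<close> kills \<open>P\<close>, and \<open>x - z\<close> kills \<open>Q\<close>; here \<open>y = -z\<close>.
\<close>

lemma injective_rmodule_ann_Int:
  assumes inj: "injective_rmodule R E" and P: "ideal P R" and Q: "ideal Q R"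
    and x: "x \<in> carrier E" "\<And>b. b \<in> P \<inter> Q \<Longrightarrow> x \<odot>\<^sub>r\<^bsub>E\<^esub> b = \<zero>\<^bsub>E\<^esub>"
  obtains y where "y \<in> ann_in E P" "x \<oplus>\<^bsub>E\<^esub> y \<in> ann_in E Q"
proof -
  interpret E: right_module R E using inj by (rule injective_rmodule_right_module)
  interpret P: ideal P R by fact
  interpret Q: ideal Q R by fact
  let ?RR = "right_regular R"
  have RR: "right_module R ?RR" by (rule right_module_right_regular) (rule E.ring_axioms)
  define G where "G = {(p \<oplus>\<^bsub>R\<^esub> q, x \<odot>\<^sub>r\<^bsub>E\<^esub> q) | p q. p \<in> P \<and> q \<in> Q}"
  have GI: "(r, v) \<in> G" if "p \<in> P" "q \<in> Q" "r = p \<oplus>\<^bsub>R\<^esub> q" "v = x \<odot>\<^sub>r\<^bsub>E\<^esub> q" for p q r v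
    using that by (auto simp: G_def)
  have GE: "\<exists>p q. p \<in> P \<and> q \<in> Q \<and> r = p \<oplus>\<^bsub>R\<^esub> q \<and> v = x \<odot>\<^sub>r\<^bsub>E\<^esub> q" if "(r, v) \<in> G" for r v
    using that by (auto simp: G_def)
  obtain h where h: "h \<in> rmod_hom R ?RR E" and hG: "\<And>r v. (r, v) \<in> G \<Longrightarrow> h r = v"
  proof (rule injective_rmodule_extend_graph[OF inj RR, of G])
    show "G \<subseteq> carrier ?RR \<times> carrier E"
      by (auto simp: G_def right_regular_def P.Icarr Q.Icarr x E.rsmult_closed)
    show "(\<zero>\<^bsub>?RR\<^esub>, \<zero>\<^bsub>E\<^esub>) \<in> G"
      by (rule GI[of "\<zero>\<^bsub>R\<^esub>" "\<zero>\<^bsub>R\<^esub>"])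
         (simp_all add: right_regular_def E.rsmult_zero x)
  next
    fix r v r' v' assume "(r, v) \<in> G" "(r', v') \<in> G"
    then obtain p q p' q' where
      *: "p \<in> P" "q \<in> Q" "r = p \<oplus>\<^bsub>R\<^esub> q" "v = x \<odot>\<^sub>r\<^bsub>E\<^esub> q"
         "p' \<in> P" "q' \<in> Q" "r' = p' \<oplus>\<^bsub>R\<^esub> q'" "v' = x \<odot>\<^sub>r\<^bsub>E\<^esub> q'"
      using GE by meson
    note c = P.Icarr[OF *(1)] Q.Icarr[OF *(2)] P.Icarr[OF *(5)] Q.Icarr[OF *(6)]
    show "(r \<oplus>\<^bsub>?RR\<^esub> r', v \<oplus>\<^bsub>E\<^esub> v') \<in> G"
    proof (rule GI[of "p \<oplus>\<^bsub>R\<^esub> p'" "q \<oplus>\<^bsub>R\<^esub> q'"])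
      show "r \<oplus>\<^bsub>?RR\<^esub> r' = p \<oplus>\<^bsub>R\<^esub> p' \<oplus>\<^bsub>R\<^esub> (q \<oplus>\<^bsub>R\<^esub> q')"
        using c unfolding *(3,7) by (simp add: right_regular_def E.R.a_ac)
      show "v \<oplus>\<^bsub>E\<^esub> v' = x \<odot>\<^sub>r\<^bsub>E\<^esub> (q \<oplus>\<^bsub>R\<^esub> q')"
        using c x unfolding *(4,8) by (simp add: E.rsmult_r_distr)
    qed (fact P.a_closed[OF *(1,5)] Q.a_closed[OF *(2,6)])+
  next
    fix r v s assume "(r, v) \<in> G" "s \<in> carrier R"
    then obtain p q where *: "p \<in> P" "q \<in> Q" "r = p \<oplus>\<^bsub>R\<^esub> q" "v = x \<odot>\<^sub>r\<^bsub>E\<^esub> q" "s \<in> carrier R"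
      using GE by meson
    show "(r \<odot>\<^sub>r\<^bsub>?RR\<^esub> s, v \<odot>\<^sub>r\<^bsub>E\<^esub> s) \<in> G"
      by (rule GI[of "p \<otimes>\<^bsub>R\<^esub> s" "q \<otimes>\<^bsub>R\<^esub> s"])
         (use * in \<open>simp_all add: right_regular_def P.Icarr Q.Icarr x E.rsmult_assoc E.l_distr
            P.I_r_closed Q.I_r_closed\<close>)
  next
    fix v assume "(\<zero>\<^bsub>?RR\<^esub>, v) \<in> G"
    then have "(\<zero>\<^bsub>R\<^esub>, v) \<in> G" by (simp add: right_regular_def)
    then obtain p q where *: "p \<in> P" "q \<in> Q" "\<zero>\<^bsub>R\<^esub> = p \<oplus>\<^bsub>R\<^esub> q" "v = x \<odot>\<^sub>r\<^bsub>E\<^esub> q"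
      using GE by meson
    then have "q = \<ominus>\<^bsub>R\<^esub> p"
      by (metis E.R.minus_equality E.R.a_comm P.Icarr Q.Icarr)
    then have "q \<in> P" using *(1) by (simp add: P.a_inv_closed)
    then show "v = \<zero>\<^bsub>E\<^esub>" using *(2) x(2)[of q] unfolding *(4) by simp
  qed blast
  define y where "y = \<ominus>\<^bsub>E\<^esub> h \<one>\<^bsub>R\<^esub>"
  have h1: "h \<one>\<^bsub>R\<^esub> \<in> carrier E" using rmod_hom_closed[OF h] by (simp add: right_regular_def)
  have h1_smult: "h \<one>\<^bsub>R\<^esub> \<odot>\<^sub>r\<^bsub>E\<^esub> r = h r" if "r \<in> carrier R" for r
    using rmod_hom_rsmult[OF h, of "\<one>\<^bsub>R\<^esub>" r] that by (simp add: right_regular_def)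
  have "h p = \<zero>\<^bsub>E\<^esub>" if "p \<in> P" for p
    by (rule hG[OF GI[of p "\<zero>\<^bsub>R\<^esub>"]]) (use that in \<open>simp_all add: P.Icarr E.rsmult_zero x\<close>)
  then have "h \<one>\<^bsub>R\<^esub> \<in> ann_in E P" using h1 by (simp add: ann_in_def h1_smult P.Icarr)
  then have y: "y \<in> ann_in E P"
    unfolding y_def by (rule submod_neg[OF E.right_module_axioms submod_ann_in[OF E.right_module_axioms P]])
  have "h q = x \<odot>\<^sub>r\<^bsub>E\<^esub> q" if "q \<in> Q" for q
    by (rule hG[OF GI[of "\<zero>\<^bsub>R\<^esub>" q]]) (use that in \<open>simp_all add: Q.Icarr\<close>)
  then have "(x \<oplus>\<^bsub>E\<^esub> y) \<odot>\<^sub>r\<^bsub>E\<^esub> q = \<zero>\<^bsub>E\<^esub>" if "q \<in> Q" for q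
    using that x h1 unfolding y_def
    by (simp add: E.rsmult_l_distr E.minus_rsmult Q.Icarr h1_smult E.M.r_neg E.rsmult_closed)
  then have "x \<oplus>\<^bsub>E\<^esub> y \<in> ann_in E Q" using x h1 by (simp add: ann_in_def y_def)
  with y show thesis by (rule that)
qed

text \<open>
  By \<open>Ext1_nonzero_iff\<close> the question is which homomorphisms from \<open>K\<close> to \<open>ann\<^sub>E(Q)\<close> extend to the free
  module \<open>F\<^sub>0\<close> on the set \<open>R/P\<close>, where \<open>K\<close> is the kernel of \<open>F\<^sub>0 \<rightarrow> R/P\<close>. Let \<open>e \<in> F\<^sub>0\<close> be the basis
  element over the coset of \<open>1\<close>, so that \<open>e P \<subseteq> K\<close>.

  Any such homomorphism extends to some \<open>h\<close> from \<open>F\<^sub>0\<close> to \<open>E\<close>, and \<open>x = h(e)\<close> satisfies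
  \<open>x P Q = 0\<close>. If also \<open>x (P \<inter> Q) = 0\<close>, then \<open>x + y\<close> kills \<open>Q\<close> for some \<open>y\<close> killing \<open>P\<close>;
  adding to \<open>h\<close> the map from \<open>R/P\<close> to \<open>E\<close> determined by \<open>y\<close> leaves it unchanged on \<open>K\<close> and moves
  all its values into \<open>ann\<^sub>E(Q)\<close>.

  Conversely, given \<open>x\<close>, lift the augmentation to a homomorphism from \<open>F\<^sub>0\<close> to \<open>R\<close> and multiply by
  \<open>x\<close>. On \<open>K\<close> the values lie in \<open>x P\<close>, hence in \<open>ann\<^sub>E(Q)\<close>. At \<open>e b\<close>, with \<open>b \<in> P \<inter> Q\<close>, the
  value is \<open>x b\<close>, while an extension to \<open>F\<^sub>0\<close> with values in \<open>ann\<^sub>E(Q)\<close> would vanish there.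
\<close>

lemma Ext1_factor_ann_iff:
  assumes inj: "injective_rmodule R E" and P: "ideal P R" and Q: "ideal Q R"
  shows "Ext1_nonzero R (factor_rmodule R P) (E\<lparr>carrier := ann_in E Q\<rparr>) \<longleftrightarrow>
    (\<exists>x\<in>carrier E. (\<forall>p\<in>P. \<forall>q\<in>Q. x \<odot>\<^sub>r\<^bsub>E\<^esub> (p \<otimes>\<^bsub>R\<^esub> q) = \<zero>\<^bsub>E\<^esub>) \<and>
       (\<exists>b\<in>P \<inter> Q. x \<odot>\<^sub>r\<^bsub>E\<^esub> b \<noteq> \<zero>\<^bsub>E\<^esub>))"
proof -
  interpret E: right_module R E using inj by (rule injective_rmodule_right_module)
  interpret P: ideal P R by fact
  interpret Q: ideal Q R by fact
  define A where "A = factor_rmodule R P"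
  define B where "B = E\<lparr>carrier := ann_in E Q\<rparr>"
  define F0 where "F0 = res_F0 R A"
  define aug where "aug = res_aug R A"
  define K where "K = a_kernel F0 A aug"
  interpret A: right_module R A unfolding A_def by (rule right_module_factor_rmodule[OF P])
  interpret F0: right_module R F0
    unfolding F0_def res_F0_def by (rule right_module_free_rmodule) (rule E.ring_axioms)
  have annQ: "submod R E (ann_in E Q)" by (rule submod_ann_in[OF E.right_module_axioms Q])
  interpret B: right_module R B
    unfolding B_def by (rule right_module_submod[OF E.right_module_axioms annQ])
  have A_sub: "submod R A (carrier A)" by (rule A.submodI) (auto simp: A.rsmult_closed)
  have aug: "aug \<in> rmod_hom R F0 A"
    and aug_basis: "\<And>s. s \<in> carrier A \<Longrightarrow> aug (free_basis R s) = s"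
    unfolding aug_def res_aug_def F0_def res_F0_def using A.free_map_hom[OF A_sub] by blast+
  have K: "submod R F0 K"
    unfolding K_def by (rule submod_kernel[OF F0.right_module_axioms A.right_module_axioms aug])
  interpret K: right_module R "F0\<lparr>carrier := K\<rparr>"
    by (rule right_module_submod[OF F0.right_module_axioms K])
  have K_iff: "k \<in> K \<longleftrightarrow> k \<in> carrier F0 \<and> aug k = \<zero>\<^bsub>A\<^esub>" for k
    by (auto simp: K_def a_kernel_def kernel_def)
  define one where "one = P +>\<^bsub>R\<^esub> \<one>\<^bsub>R\<^esub>"
  have one: "one \<in> carrier A"
    unfolding one_def A_def by (rule factor_rmodule_coset_closed[OF P]) simp
  have one_smult: "one \<odot>\<^sub>r\<^bsub>A\<^esub> r = P +>\<^bsub>R\<^esub> r" if "r \<in> carrier R" for r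
    using factor_rmodule_coset_rsmult[OF P _ that, of "\<one>\<^bsub>R\<^esub>"] that by (simp add: one_def A_def)
  have one_smult_zero: "one \<odot>\<^sub>r\<^bsub>A\<^esub> r = \<zero>\<^bsub>A\<^esub> \<longleftrightarrow> r \<in> P" if "r \<in> carrier R" for r
    using factor_rmodule_coset_iff[OF P that] one_smult[OF that] by (simp add: A_def)
  define e where "e = free_basis R one"
  have e: "e \<in> carrier F0"
    unfolding e_def F0_def res_F0_def by (rule free_basis_in_free_rmodule[OF E.ring_axioms one])
  have aug_e: "aug e = one" unfolding e_def by (rule aug_basis[OF one])
  have e_smult_K: "e \<odot>\<^sub>r\<^bsub>F0\<^esub> p \<in> K" if "p \<in> P" for p
    using that e by (simp add: K_iff rmod_hom_rsmult[OF aug] aug_e one_smult_zero P.Icarr F0.rsmult_closed)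

  have "Ext1_nonzero R A B \<longleftrightarrow> (\<exists>g \<in> rmod_hom R (F0\<lparr>carrier := K\<rparr>) B.
      \<not> (\<exists>h \<in> rmod_hom R F0 B. \<forall>k\<in>K. h k = g k))"
    unfolding F0_def K_def aug_def
    by (rule Ext1_nonzero_iff[OF A.right_module_axioms B.right_module_axioms])
  also have "\<dots> \<longleftrightarrow> (\<exists>x\<in>carrier E. (\<forall>p\<in>P. \<forall>q\<in>Q. x \<odot>\<^sub>r\<^bsub>E\<^esub> (p \<otimes>\<^bsub>R\<^esub> q) = \<zero>\<^bsub>E\<^esub>) \<and>
       (\<exists>b\<in>P \<inter> Q. x \<odot>\<^sub>r\<^bsub>E\<^esub> b \<noteq> \<zero>\<^bsub>E\<^esub>))"
  proof
    assume "\<exists>g \<in> rmod_hom R (F0\<lparr>carrier := K\<rparr>) B. \<not> (\<exists>h \<in> rmod_hom R F0 B. \<forall>k\<in>K. h k = g k)"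
    then obtain g where g: "g \<in> rmod_hom R (F0\<lparr>carrier := K\<rparr>) B"
      and no_ext: "\<And>h. h \<in> rmod_hom R F0 B \<Longrightarrow> \<exists>k\<in>K. h k \<noteq> g k" by blast
    have g_ann: "g k \<in> ann_in E Q" if "k \<in> K" for k
      using rmod_hom_closed[OF g] that by (simp add: B_def)
    have gE: "g \<in> rmod_hom R (F0\<lparr>carrier := K\<rparr>) E"
      using g submod_subset[OF annQ] by (auto simp: rmod_hom_def B_def)
    have "injective_for TYPE('a set \<Rightarrow> 'a) R E" using inj by (rule injective_rmodule_imp_injective_for)
    then obtain h where h: "h \<in> rmod_hom R F0 E" and hg: "\<And>k. k \<in> K \<Longrightarrow> h k = g k"
      using gE K F0.right_module_axioms unfolding injective_for_def by blast
    define x where "x = h e"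
    have x: "x \<in> carrier E" unfolding x_def by (rule rmod_hom_closed[OF h e])
    have x_smult: "x \<odot>\<^sub>r\<^bsub>E\<^esub> p \<in> ann_in E Q" if "p \<in> P" for p
      using g_ann[OF e_smult_K[OF that]] hg[OF e_smult_K[OF that]] that
      by (simp add: x_def rmod_hom_rsmult[OF h e] P.Icarr)
    have "x \<odot>\<^sub>r\<^bsub>E\<^esub> (p \<otimes>\<^bsub>R\<^esub> q) = \<zero>\<^bsub>E\<^esub>" if "p \<in> P" "q \<in> Q" for p q
      using x_smult[OF that(1)] that x by (simp add: ann_in_def E.rsmult_assoc P.Icarr Q.Icarr)
    moreover have "\<exists>b\<in>P \<inter> Q. x \<odot>\<^sub>r\<^bsub>E\<^esub> b \<noteq> \<zero>\<^bsub>E\<^esub>"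
    proof (rule ccontr)
      assume "\<not> ?thesis"
      then have x0: "x \<odot>\<^sub>r\<^bsub>E\<^esub> b = \<zero>\<^bsub>E\<^esub>" if "b \<in> P \<inter> Q" for b using that by blast
      obtain y where y: "y \<in> ann_in E P" and xy: "x \<oplus>\<^bsub>E\<^esub> y \<in> ann_in E Q"
        by (rule injective_rmodule_ann_Int[OF inj P Q x x0])
      have yE: "y \<in> carrier E" using y by (simp add: ann_in_def)
      obtain \<eta> where \<eta>: "\<eta> \<in> rmod_hom R A E" and \<eta>_one: "\<eta> one = y"
      proof (rule injective_rmodule_extend_cyclic[OF inj A.right_module_axioms one yE])
        show "y \<odot>\<^sub>r\<^bsub>E\<^esub> r = \<zero>\<^bsub>E\<^esub>" if "r \<in> carrier R" "one \<odot>\<^sub>r\<^bsub>A\<^esub> r = \<zero>\<^bsub>A\<^esub>" for r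
          using that y by (simp add: one_smult_zero ann_in_def)
      qed blast
      \<comment> \<open>the sum of \<open>h\<close> and \<open>\<eta> \<circ> aug\<close>\<close>
      define h' where "h' = h \<otimes>\<^bsub>Hom_group R F0 E\<^esub> compose (carrier F0) \<eta> aug"
      interpret H: group "Hom_group R F0 E"
        by (rule group_Hom_group[OF F0.right_module_axioms E.right_module_axioms])
      have h': "h' \<in> rmod_hom R F0 E"
        using H.m_closed[of h "compose (carrier F0) \<eta> aug"] h
          compose_rmod_hom[OF F0.right_module_axioms aug \<eta>]
        by (simp add: h'_def Hom_group_def)
      have h'_eq: "h' c = h c \<oplus>\<^bsub>E\<^esub> \<eta> (aug c)" if "c \<in> carrier F0" for c
        using that by (simp add: h'_def Hom_group_def compose_def)
      have \<eta>_zero: "\<eta> \<zero>\<^bsub>A\<^esub> = \<zero>\<^bsub>E\<^esub>"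
        by (rule rmod_hom_zero[OF A.right_module_axioms E.right_module_axioms \<eta>])
      have h'_K: "h' k = g k" if k: "k \<in> K" for k
      proof -
        have "k \<in> carrier F0" "aug k = \<zero>\<^bsub>A\<^esub>" using k by (simp_all add: K_iff)
        then show ?thesis using rmod_hom_closed[OF gE] k by (simp add: h'_eq \<eta>_zero hg)
      qed
      have h'_e: "h' e = x \<oplus>\<^bsub>E\<^esub> y" using e by (simp add: h'_eq aug_e \<eta>_one x_def)
      have "h' c \<in> ann_in E Q" if c: "c \<in> carrier F0" for c
      proof -
        \<comment> \<open>modulo \<open>K\<close>, every element of \<open>F0\<close> is a multiple of \<open>e\<close>\<close>
        obtain r where r: "r \<in> carrier R" "aug c = P +>\<^bsub>R\<^esub> r"
          using rmod_hom_closed[OF aug c] unfolding A_def by (rule factor_rmodule_cases)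
        define k where "k = c \<oplus>\<^bsub>F0\<^esub> \<ominus>\<^bsub>F0\<^esub> (e \<odot>\<^sub>r\<^bsub>F0\<^esub> r)"
        have er: "e \<odot>\<^sub>r\<^bsub>F0\<^esub> r \<in> carrier F0" using e r by (simp add: F0.rsmult_closed)
        have k: "k \<in> carrier F0" using c er by (simp add: k_def)
        have "k \<in> K"
          using c er k r one rmod_hom_closed[OF aug c]
          by (simp add: K_iff) (simp add: k_def rmod_hom_add[OF aug]
              rmod_hom_neg[OF F0.right_module_axioms A.right_module_axioms aug]
              rmod_hom_rsmult[OF aug e] aug_e one_smult[symmetric] A.M.r_neg A.rsmult_closed)
        moreover have "c = k \<oplus>\<^bsub>F0\<^esub> e \<odot>\<^sub>r\<^bsub>F0\<^esub> r"
          using c er by (simp add: k_def F0.M.a_assoc F0.M.l_neg)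
        then have "h' c = h' k \<oplus>\<^bsub>E\<^esub> (x \<oplus>\<^bsub>E\<^esub> y) \<odot>\<^sub>r\<^bsub>E\<^esub> r"
          using k er r by (metis h'_e rmod_hom_add[OF h'] rmod_hom_rsmult[OF h' e])
        ultimately show ?thesis
          using submod_add[OF annQ] submod_rsmult[OF annQ xy r(1)] g_ann h'_K by simp
      qed
      then have "h' \<in> rmod_hom R F0 B"
        using h' by (auto simp: rmod_hom_def B_def PiE_def)
      then show False using no_ext h'_K by blast
    qed
    ultimately show "\<exists>x\<in>carrier E. (\<forall>p\<in>P. \<forall>q\<in>Q. x \<odot>\<^sub>r\<^bsub>E\<^esub> (p \<otimes>\<^bsub>R\<^esub> q) = \<zero>\<^bsub>E\<^esub>) \<and>
       (\<exists>b\<in>P \<inter> Q. x \<odot>\<^sub>r\<^bsub>E\<^esub> b \<noteq> \<zero>\<^bsub>E\<^esub>)" using x by blast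
  next
    assume "\<exists>x\<in>carrier E. (\<forall>p\<in>P. \<forall>q\<in>Q. x \<odot>\<^sub>r\<^bsub>E\<^esub> (p \<otimes>\<^bsub>R\<^esub> q) = \<zero>\<^bsub>E\<^esub>) \<and>
       (\<exists>b\<in>P \<inter> Q. x \<odot>\<^sub>r\<^bsub>E\<^esub> b \<noteq> \<zero>\<^bsub>E\<^esub>)"
    then obtain x b where x: "x \<in> carrier E" and b: "b \<in> P" "b \<in> Q" "x \<odot>\<^sub>r\<^bsub>E\<^esub> b \<noteq> \<zero>\<^bsub>E\<^esub>"
      and xPQ: "\<And>p q. p \<in> P \<Longrightarrow> q \<in> Q \<Longrightarrow> x \<odot>\<^sub>r\<^bsub>E\<^esub> (p \<otimes>\<^bsub>R\<^esub> q) = \<zero>\<^bsub>E\<^esub>" by blast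
    let ?RR = "right_regular R"
    interpret RR: right_module R ?RR by (rule right_module_right_regular) (rule E.ring_axioms)
    define \<pi> where "\<pi> = (\<lambda>r\<in>carrier ?RR. P +>\<^bsub>R\<^esub> r)"
    have \<pi>: "\<pi> \<in> rmod_hom R ?RR A"
      unfolding \<pi>_def
    proof (rule RR.restrict_rmod_homI)
      show "P +>\<^bsub>R\<^esub> r \<in> carrier A" if "r \<in> carrier ?RR" for r
        using that factor_rmodule_coset_closed[OF P] by (simp add: A_def right_regular_def)
      show "P +>\<^bsub>R\<^esub> (r \<oplus>\<^bsub>?RR\<^esub> s) = (P +>\<^bsub>R\<^esub> r) \<oplus>\<^bsub>A\<^esub> (P +>\<^bsub>R\<^esub> s)"
        if "r \<in> carrier ?RR" "s \<in> carrier ?RR" for r s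
        using that ring_hom_add[OF P.rcos_ring_hom]
        by (simp add: A_def right_regular_def factor_rmodule_def)
      show "P +>\<^bsub>R\<^esub> (r \<odot>\<^sub>r\<^bsub>?RR\<^esub> s) = (P +>\<^bsub>R\<^esub> r) \<odot>\<^sub>r\<^bsub>A\<^esub> s"
        if "r \<in> carrier ?RR" "s \<in> carrier R" for r s
        using that factor_rmodule_coset_rsmult[OF P] by (simp add: A_def right_regular_def)
    qed
    define \<rho> where "\<rho> s = (SOME r. r \<in> carrier R \<and> s = P +>\<^bsub>R\<^esub> r)" for s
    have \<rho>: "\<rho> s \<in> carrier R \<and> s = P +>\<^bsub>R\<^esub> \<rho> s" if "s \<in> carrier A" for s
    proof -
      have "s \<in> carrier (factor_rmodule R P)" using that by (simp add: A_def)
      then obtain a where "a \<in> carrier R" "s = P +>\<^bsub>R\<^esub> a" by (rule factor_rmodule_cases)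
      then show ?thesis
        unfolding \<rho>_def by (intro someI[of "\<lambda>r. r \<in> carrier R \<and> s = P +>\<^bsub>R\<^esub> r" a]) simp
    qed
    define \<phi> where "\<phi> = free_lift R ?RR (carrier A) \<rho>"
    have \<rho>_RR: "\<rho> s \<in> carrier ?RR" if "s \<in> carrier A" for s
      using \<rho>[OF that] by (simp add: right_regular_def)
    have \<phi>: "\<phi> \<in> rmod_hom R F0 ?RR"
      unfolding \<phi>_def F0_def res_F0_def by (rule RR.free_lift_hom) (rule \<rho>_RR)
    have \<phi>_in: "\<phi> c \<in> carrier R" if "c \<in> carrier F0" for c
      using rmod_hom_closed[OF \<phi> that] by (simp add: right_regular_def)
    have \<pi>_\<phi>: "P +>\<^bsub>R\<^esub> \<phi> c = aug c" if c: "c \<in> carrier F0" for c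
    proof -
      have "\<pi> (\<phi> c) = aug c"
        unfolding \<phi>_def aug_def res_aug_def free_map_eq_free_lift
        using c \<rho> \<rho>_RR unfolding F0_def res_F0_def
        by (intro rmod_hom_free_lift[OF RR.right_module_axioms A.right_module_axioms \<pi>])
           (auto simp: \<pi>_def)
      then show ?thesis using \<phi>_in[OF c] by (simp add: \<pi>_def right_regular_def)
    qed
    define g where "g = (\<lambda>k\<in>carrier (F0\<lparr>carrier := K\<rparr>). x \<odot>\<^sub>r\<^bsub>E\<^esub> \<phi> k)"
    have "g \<in> rmod_hom R (F0\<lparr>carrier := K\<rparr>) B"
      unfolding g_def
    proof (rule K.restrict_rmod_homI)
      have K_F0: "k \<in> carrier F0" if "k \<in> K" for k using that by (simp add: K_iff)
      show "x \<odot>\<^sub>r\<^bsub>E\<^esub> \<phi> k \<in> carrier B" if "k \<in> carrier (F0\<lparr>carrier := K\<rparr>)" for k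
      proof -
        have k: "k \<in> carrier F0" "aug k = \<zero>\<^bsub>A\<^esub>" using that by (simp_all add: K_iff)
        then have "\<phi> k \<in> P"
          using \<pi>_\<phi>[OF k(1)] factor_rmodule_coset_iff[OF P \<phi>_in[OF k(1)]] by (simp add: A_def)
        then show ?thesis
          using x xPQ
          by (simp add: B_def ann_in_def E.rsmult_closed P.Icarr Q.Icarr E.rsmult_assoc[symmetric])
      qed
      show "x \<odot>\<^sub>r\<^bsub>E\<^esub> \<phi> (k \<oplus>\<^bsub>F0\<lparr>carrier := K\<rparr>\<^esub> k') = x \<odot>\<^sub>r\<^bsub>E\<^esub> \<phi> k \<oplus>\<^bsub>B\<^esub> x \<odot>\<^sub>r\<^bsub>E\<^esub> \<phi> k'"
        if "k \<in> carrier (F0\<lparr>carrier := K\<rparr>)" "k' \<in> carrier (F0\<lparr>carrier := K\<rparr>)" for k k'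
        using that x rmod_hom_add[OF \<phi>, of k k']
        by (simp add: K_F0 B_def \<phi>_in E.rsmult_r_distr right_regular_def)
      show "x \<odot>\<^sub>r\<^bsub>E\<^esub> \<phi> (k \<odot>\<^sub>r\<^bsub>F0\<lparr>carrier := K\<rparr>\<^esub> r) = (x \<odot>\<^sub>r\<^bsub>E\<^esub> \<phi> k) \<odot>\<^sub>r\<^bsub>B\<^esub> r"
        if "k \<in> carrier (F0\<lparr>carrier := K\<rparr>)" "r \<in> carrier R" for k r
        using that x rmod_hom_rsmult[OF \<phi>, of k r]
        by (simp add: K_F0 B_def \<phi>_in E.rsmult_assoc right_regular_def)
    qed
    moreover have "\<not> (\<exists>h \<in> rmod_hom R F0 B. \<forall>k\<in>K. h k = g k)"
    proof
      assume "\<exists>h \<in> rmod_hom R F0 B. \<forall>k\<in>K. h k = g k"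
      then obtain h where h: "h \<in> rmod_hom R F0 B" and hg: "\<And>k. k \<in> K \<Longrightarrow> h k = g k" by blast
      have bR: "b \<in> carrier R" using b by (simp add: P.Icarr)
      have eb: "e \<odot>\<^sub>r\<^bsub>F0\<^esub> b \<in> K" by (rule e_smult_K[OF b(1)])
      have "h e \<in> ann_in E Q" using rmod_hom_closed[OF h e] by (simp add: B_def)
      then have "h (e \<odot>\<^sub>r\<^bsub>F0\<^esub> b) = \<zero>\<^bsub>E\<^esub>"
        using b(2) by (simp add: rmod_hom_rsmult[OF h e bR] B_def ann_in_def)
      then have "g (e \<odot>\<^sub>r\<^bsub>F0\<^esub> b) = \<zero>\<^bsub>E\<^esub>" using hg[OF eb] by simp
      then have xeb: "x \<odot>\<^sub>r\<^bsub>E\<^esub> (\<phi> e \<otimes>\<^bsub>R\<^esub> b) = \<zero>\<^bsub>E\<^esub>"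
        using eb rmod_hom_rsmult[OF \<phi> e bR] by (simp add: g_def right_regular_def)
      \<comment> \<open>the chosen representative \<open>\<phi> e\<close> of the coset of \<open>1\<close> need not be \<open>1\<close>; the difference lies in
        \<open>P\<close> and is killed because \<open>x P Q = 0\<close>\<close>
      have "P +>\<^bsub>R\<^esub> \<phi> e = P +>\<^bsub>R\<^esub> \<one>\<^bsub>R\<^esub>" using \<pi>_\<phi>[OF e] aug_e by (simp add: one_def)
      then have "\<phi> e \<in> P +>\<^bsub>R\<^esub> \<one>\<^bsub>R\<^esub>" using P.a_rcos_self[OF \<phi>_in[OF e]] by simp
      then obtain p where p: "p \<in> P" "\<phi> e = p \<oplus>\<^bsub>R\<^esub> \<one>\<^bsub>R\<^esub>" by (auto simp: a_r_coset_def')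
      have "x \<odot>\<^sub>r\<^bsub>E\<^esub> (\<phi> e \<otimes>\<^bsub>R\<^esub> b) = x \<odot>\<^sub>r\<^bsub>E\<^esub> b"
        using p b bR x xPQ[OF p(1) b(2)]
        by (simp add: E.l_distr P.Icarr E.rsmult_r_distr E.rsmult_closed)
      then show False using xeb b(3) by simp
    qed
    ultimately show "\<exists>g \<in> rmod_hom R (F0\<lparr>carrier := K\<rparr>) B.
      \<not> (\<exists>h \<in> rmod_hom R F0 B. \<forall>k\<in>K. h k = g k)" by blast
  qed
  finally show ?thesis unfolding A_def B_def .
qed

section \<open>Homomorphisms out of the injective hull of a uniform right ideal\<close>

text \<open>
  A nonzero multiple \<open>w r\<close> of \<open>w\<close> lies in the essential right ideal \<open>V\<close> of \<open>R/Q\<close>, where it is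
  \<open>Q + a\<close> with \<open>a \<notin> Q\<close>, and so its annihilator is \<open>{s. a s \<in> Q}\<close>. If \<open>c \<in> E\<close> is killed by \<open>Q\<close>, then
  \<open>c a\<close> is killed by this annihilator, so \<open>w r \<mapsto> c a\<close> defines a homomorphism. The assassinator
  provides such a \<open>c\<close> with \<open>c a \<noteq> 0\<close>. Over a ring that is noetherian on one side only, \<open>E\<close> and
  \<open>E\<^sub>Q\<close> can differ, and homomorphisms between them replace an isomorphism.
\<close>

lemma is_EQ_separated_by_homs:
  assumes Q: "ideal Q R" and EQ: "is_EQ R Q EQ"
    and inj: "injective_rmodule R E" and ass: "is_assassinator R E Q"
    and w: "w \<in> carrier EQ" "w \<noteq> \<zero>\<^bsub>EQ\<^esub>"
  obtains G where "G \<in> rmod_hom R EQ E" "G w \<noteq> \<zero>\<^bsub>E\<^esub>"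
proof -
  let ?A = "factor_rmodule R Q"
  obtain V where V: "right_ideal (R Quot Q) V" and hull: "is_injective_hull R (?A\<lparr>carrier := V\<rparr>) EQ"
    using EQ unfolding is_EQ_def by blast
  then obtain i where injEQ: "injective_rmodule R EQ"
    and i: "i \<in> rmod_hom R (?A\<lparr>carrier := V\<rparr>) EQ" and i_inj: "inj_on i V"
    and ess: "essential_submod R EQ (i ` V)"
    unfolding is_injective_hull_def by auto
  interpret E: right_module R E using inj by (rule injective_rmodule_right_module)
  interpret EQ: right_module R EQ using injEQ by (rule injective_rmodule_right_module)
  interpret Q: ideal Q R by fact
  have A: "right_module R ?A" by (rule right_module_factor_rmodule[OF Q])
  have VA: "submod R ?A V"
  proof (rule right_module.submodI[OF A])
    note V' = V[unfolded right_ideal_def]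
    show "V \<subseteq> carrier ?A" "\<zero>\<^bsub>?A\<^esub> \<in> V"
      using submod_subset[OF V'] submod_zero[OF V'] by (simp_all add: right_regular_def factor_rmodule_def)
    show "X \<oplus>\<^bsub>?A\<^esub> Y \<in> V" if "X \<in> V" "Y \<in> V" for X Y
      using submod_add[OF V' that] by (simp add: right_regular_def factor_rmodule_def)
    show "X \<odot>\<^sub>r\<^bsub>?A\<^esub> r \<in> V" if "X \<in> V" "r \<in> carrier R" for X r
      using submod_rsmult[OF V' that(1), of "Q +>\<^bsub>R\<^esub> r"] ring_hom_closed[OF Q.rcos_ring_hom that(2)]
      by (simp add: right_regular_def factor_rmodule_def)
  qed
  have i_zero: "i \<zero>\<^bsub>?A\<^esub> = \<zero>\<^bsub>EQ\<^esub>"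
    using rmod_hom_zero[OF right_module_submod[OF A VA] EQ.right_module_axioms i] by simp
  have i_eq_zero: "v = \<zero>\<^bsub>?A\<^esub>" if "v \<in> V" "i v = \<zero>\<^bsub>EQ\<^esub>" for v
    by (rule inj_onD[OF i_inj _ that(1) submod_zero[OF VA]]) (simp only: that(2) i_zero)

  define W where "W = (\<lambda>r. w \<odot>\<^sub>r\<^bsub>EQ\<^esub> r) ` carrier R"
  have "submod R EQ W"
  proof (rule EQ.submodI)
    show "\<zero>\<^bsub>EQ\<^esub> \<in> W"
      unfolding W_def by (rule image_eqI[of _ _ "\<zero>\<^bsub>R\<^esub>"]) (simp_all add: EQ.rsmult_zero w)
    show "x \<oplus>\<^bsub>EQ\<^esub> y \<in> W" if "x \<in> W" "y \<in> W" for x y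
      using that w by (auto simp: W_def EQ.rsmult_r_distr[symmetric])
    show "x \<odot>\<^sub>r\<^bsub>EQ\<^esub> r \<in> W" if "x \<in> W" "r \<in> carrier R" for x r
      using that w by (auto simp: W_def EQ.rsmult_assoc[symmetric])
  qed (use w in \<open>auto simp: W_def EQ.rsmult_closed\<close>)
  moreover have "w \<in> W"
    unfolding W_def by (rule image_eqI[of _ _ "\<one>\<^bsub>R\<^esub>"]) (simp_all add: EQ.rsmult_one w)
  ultimately have "W \<inter> i ` V \<noteq> {\<zero>\<^bsub>EQ\<^esub>}" and "submod R EQ (i ` V)" "submod R EQ W"
    using ess w(2) by (auto simp: essential_submod_def)
  moreover from this have "\<zero>\<^bsub>EQ\<^esub> \<in> W \<inter> i ` V" by (auto dest: submod_zero)
  ultimately obtain u where "u \<in> W" "u \<in> i ` V" "u \<noteq> \<zero>\<^bsub>EQ\<^esub>" by blast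
  then obtain r v where r: "r \<in> carrier R" and v: "v \<in> V" and wr: "w \<odot>\<^sub>r\<^bsub>EQ\<^esub> r = i v"
    and nz: "i v \<noteq> \<zero>\<^bsub>EQ\<^esub>" by (auto simp: W_def)
  have "v \<in> carrier ?A" using v submod_subset[OF VA] by blast
  then obtain a where a: "a \<in> carrier R" "v = Q +>\<^bsub>R\<^esub> a" by (rule factor_rmodule_cases)
  have "a \<notin> Q" using factor_rmodule_coset_iff[OF Q a(1)] a(2) nz i_zero by auto

  have "Q \<in> associated_primes R E" using ass by (simp add: is_assassinator_def)
  then obtain N where N: "prime_submod R E N" "Q = annihilator R E N"
    unfolding associated_primes_def by blast
  have "a \<notin> annihilator R E N" using \<open>a \<notin> Q\<close> N(2) by blast
  then obtain c where c: "c \<in> N" "c \<odot>\<^sub>r\<^bsub>E\<^esub> a \<noteq> \<zero>\<^bsub>E\<^esub>"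
    using a(1) unfolding annihilator_def by blast
  have "submod R E N" using N(1) by (simp add: prime_submod_def)
  then have cE: "c \<in> carrier E" using c(1) by (blast dest: submod_subset)
  have cQ: "c \<odot>\<^sub>r\<^bsub>E\<^esub> q = \<zero>\<^bsub>E\<^esub>" if "q \<in> Q" for q
    using that c(1) N(2) unfolding annihilator_def by blast

  have wrE: "w \<odot>\<^sub>r\<^bsub>EQ\<^esub> r \<in> carrier EQ" using w r by (simp add: EQ.rsmult_closed)
  have caE: "c \<odot>\<^sub>r\<^bsub>E\<^esub> a \<in> carrier E" using cE a by (simp add: E.rsmult_closed)
  obtain G where G: "G \<in> rmod_hom R EQ E" and Gwr: "G (w \<odot>\<^sub>r\<^bsub>EQ\<^esub> r) = c \<odot>\<^sub>r\<^bsub>E\<^esub> a"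
  proof (rule injective_rmodule_extend_cyclic[OF inj EQ.right_module_axioms wrE caE])
    fix s assume s: "s \<in> carrier R" and ws: "w \<odot>\<^sub>r\<^bsub>EQ\<^esub> r \<odot>\<^sub>r\<^bsub>EQ\<^esub> s = \<zero>\<^bsub>EQ\<^esub>"
    have "i (v \<odot>\<^sub>r\<^bsub>?A\<^esub> s) = \<zero>\<^bsub>EQ\<^esub>"
      using ws rmod_hom_rsmult[OF i, of v s] v s by (simp add: wr)
    then have "v \<odot>\<^sub>r\<^bsub>?A\<^esub> s = \<zero>\<^bsub>?A\<^esub>" by (rule i_eq_zero[OF submod_rsmult[OF VA v s]])
    then have "a \<otimes>\<^bsub>R\<^esub> s \<in> Q"
      using factor_rmodule_coset_rsmult[OF Q a(1) s] factor_rmodule_coset_iff[OF Q, of "a \<otimes>\<^bsub>R\<^esub> s"]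
        a s by simp
    then show "c \<odot>\<^sub>r\<^bsub>E\<^esub> a \<odot>\<^sub>r\<^bsub>E\<^esub> s = \<zero>\<^bsub>E\<^esub>"
      using cQ cE a s by (simp add: E.rsmult_assoc[symmetric])
  qed blast
  have "G w \<odot>\<^sub>r\<^bsub>E\<^esub> r \<noteq> \<zero>\<^bsub>E\<^esub>" using Gwr c(2) rmod_hom_rsmult[OF G w(1) r] by simp
  then have "G w \<noteq> \<zero>\<^bsub>E\<^esub>" using E.zero_rsmult[OF r] by auto
  with G show thesis by (rule that)
qed

theorem corollary3p12:
  fixes R :: "('r, 'x) ring_scheme" and P Q :: "'r set" and EQ :: "('r, 'f) rmodule"
  assumes "right_noetherian R"
    and "prime_ideal R P" and "prime_ideal R Q"
    and "is_EQ R Q EQ"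
    and "Ext1_nonzero R (factor_rmodule R P) (EQ\<lparr>carrier := ann_in EQ Q\<rparr>)"
  shows "\<forall>E :: ('r, 'e) rmodule.
           indecomposable_rmodule R E \<and> injective_rmodule R E \<and> is_assassinator R E Q \<longrightarrow>
           Ext1_nonzero R (factor_rmodule R P) (E\<lparr>carrier := ann_in E Q\<rparr>)"
proof (intro allI impI, elim conjE)
  fix E :: "('r, 'e) rmodule"
  assume inj: "injective_rmodule R E" and ass: "is_assassinator R E Q"
  have P: "ideal P R" and Q: "ideal Q R" using assms(2,3) by (simp_all add: prime_ideal_def)
  have injEQ: "injective_rmodule R EQ"
    using assms(4) by (auto simp: is_EQ_def is_injective_hull_def)
  interpret E: right_module R E using inj by (rule injective_rmodule_right_module)
  interpret EQ: right_module R EQ using injEQ by (rule injective_rmodule_right_module)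
  interpret P: ideal P R by fact
  interpret Q: ideal Q R by fact
  obtain x b where x: "x \<in> carrier EQ" and b: "b \<in> P \<inter> Q" "x \<odot>\<^sub>r\<^bsub>EQ\<^esub> b \<noteq> \<zero>\<^bsub>EQ\<^esub>"
    and xPQ: "\<And>p q. p \<in> P \<Longrightarrow> q \<in> Q \<Longrightarrow> x \<odot>\<^sub>r\<^bsub>EQ\<^esub> (p \<otimes>\<^bsub>R\<^esub> q) = \<zero>\<^bsub>EQ\<^esub>"
    using assms(5) unfolding Ext1_factor_ann_iff[OF injEQ P Q] by blast
  have bR: "b \<in> carrier R" using b by (auto simp: P.Icarr)
  obtain G where G: "G \<in> rmod_hom R EQ E" and Gxb: "G (x \<odot>\<^sub>r\<^bsub>EQ\<^esub> b) \<noteq> \<zero>\<^bsub>E\<^esub>"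
    using EQ.rsmult_closed[OF x bR] b(2)
    by (rule is_EQ_separated_by_homs[OF Q assms(4) inj ass])
  have "G x \<odot>\<^sub>r\<^bsub>E\<^esub> (p \<otimes>\<^bsub>R\<^esub> q) = \<zero>\<^bsub>E\<^esub>" if "p \<in> P" "q \<in> Q" for p q
    using rmod_hom_rsmult[OF G x, of "p \<otimes>\<^bsub>R\<^esub> q"] that
    by (simp add: P.Icarr Q.Icarr xPQ
        rmod_hom_zero[OF EQ.right_module_axioms E.right_module_axioms G])
  moreover have "G x \<odot>\<^sub>r\<^bsub>E\<^esub> b \<noteq> \<zero>\<^bsub>E\<^esub>" using Gxb rmod_hom_rsmult[OF G x bR] by simp
  ultimately show "Ext1_nonzero R (factor_rmodule R P) (E\<lparr>carrier := ann_in E Q\<rparr>)"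
    unfolding Ext1_factor_ann_iff[OF inj P Q] using rmod_hom_closed[OF G x] b(1) by blast
qed

end
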